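(* Let $\mathcal{A}=\{H_1,\ldots,H_m\}$ and $\mathcal{B}=\{K_1,\ldots,K_m\}$ be central essential hyperplane arrangements in $\mathbb{C}^d$ with the same underlying matroid. If $m\le 7$, then $\mathcal{A}$ and $\mathcal{B}$ are isotopic.
   Context: A central hyperplane arrangement $\mathcal{A}=\{H_1,\ldots,H_m\}$ in $\mathbb{C}^d$ is an (indexed) finite collection of linear hyperplanes $H_i=\ker\alpha_i$ with $\alpha_i\in(\mathbb{C}^d)^*$ nonzero. Its underlying matroid $M_{\mathcal{A}}$ is the matroid on ground set $\{1,\ldots,m\}$ whose independent sets are the $S\subseteq\{1,\ldots,m\}$ such that $\{\alpha_i\}_{i\in S}$ is linearly independent (independent of the choice of the $\alpha_i$). The rank of $\mathcal{A}$ is the rank of $M_{\mathcal{A}}$ (the dimension of the span of the $\alpha_i$), and $\mathcal{A}$ is essential if its rank is the maximal possible one (i.e. $\min(m,d)$). Two arrangements have the same underlying matroid if $M_{\mathcal{A}}=M_{\mathcal{B}}$ with respect to the given indexings. A smooth one-parameter family of arrangements $\{\mathcal{A}_t\}_{t\in(a,b)}$, $\mathcal{A}_t=\{H_1(t),\ldots,H_m(t)\}$, is one for which the coefficients of the defining equations of the $H_i(t)$ are smooth functions $(a,b)\to\mathbb{C}$. Such a family is an isotopy if all $\mathcal{A}_t$ have the same combinatorial type (for central hyperplane arrangements: the same underlying matroid). Two arrangements are isotopic if they are $\mathcal{A}_{t_1}$ and $\mathcal{A}_{t_2}$ for some isotopy $\mathcal{A}_t$. *)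

theory Defs
  imports "HOL-Analysis.Analysis"
begin

text \<open>
  Linear functionals on \<open>\<complex>\<^sup>d\<close> are given by their coefficient vectors, and an arrangement
  \<open>{H\<^sub>1, \<dots>, H\<^sub>m}\<close> by a function on \<open>nat\<close>, of which only the values at \<open>1, \<dots>, m\<close> matter.
  Repeated hyperplanes are allowed.
\<close>

definition lin_form :: "complex ^ 'd \<Rightarrow> complex ^ 'd \<Rightarrow> complex" where
  "lin_form a x = (\<Sum>j\<in>UNIV. a $ j * x $ j)"

definition defining_form :: "complex ^ 'd \<Rightarrow> (complex ^ 'd) set \<Rightarrow> bool" where
  "defining_form a H \<longleftrightarrow> a \<noteq> 0 \<and> H = {x. lin_form a x = 0}"

definition central_arrangement :: "nat \<Rightarrow> (nat \<Rightarrow> (complex ^ 'd) set) \<Rightarrow> bool" where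
  "central_arrangement m H \<longleftrightarrow> (\<forall>i\<in>{1..m}. \<exists>a. defining_form a (H i))"

text \<open>
  Linear independence of the family \<open>(\<alpha>\<^sub>i)\<close>, \<open>i \<in> S\<close>, as a family: repetitions make it dependent.
  The constant \<open>vec.dependent\<close> refers to scalars in \<open>\<complex>\<close>, the plain \<open>dependent\<close> to scalars in \<open>\<real>\<close>.
\<close>

definition lin_indep_family :: "(nat \<Rightarrow> complex ^ 'd) \<Rightarrow> nat set \<Rightarrow> bool" where
  "lin_indep_family \<alpha> S \<longleftrightarrow> inj_on \<alpha> S \<and> \<not> vec.dependent (\<alpha> ` S)"

text \<open>
  The matroid on the ground set \<open>{1..m}\<close>, given by its independent sets.  The choice of the
  defining forms is irrelevant, see \<open>matroid_of_iff\<close> below.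
\<close>

definition matroid_of :: "nat \<Rightarrow> (nat \<Rightarrow> (complex ^ 'd) set) \<Rightarrow> nat set set" where
  "matroid_of m H =
     {S. S \<subseteq> {1..m} \<and> (\<exists>\<alpha>. (\<forall>i\<in>S. defining_form (\<alpha> i) (H i)) \<and> lin_indep_family \<alpha> S)}"

definition arrangement_rank :: "nat \<Rightarrow> (nat \<Rightarrow> (complex ^ 'd) set) \<Rightarrow> nat" where
  "arrangement_rank m H = Max (card ` matroid_of m H)"

definition essential :: "nat \<Rightarrow> (nat \<Rightarrow> (complex ^ 'd) set) \<Rightarrow> bool" where
  "essential m H \<longleftrightarrow> arrangement_rank m H = min m CARD('d)"

text \<open>Infinitely differentiable; \<open>I\<close> is meant to be open.\<close>

definition smooth_on :: "real set \<Rightarrow> (real \<Rightarrow> complex) \<Rightarrow> bool" where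
  "smooth_on I f \<longleftrightarrow> (\<forall>k. ((\<lambda>g t. vector_derivative g (at t)) ^^ k) f differentiable_on I)"

definition smooth_family ::
    "nat \<Rightarrow> real \<Rightarrow> real \<Rightarrow> (real \<Rightarrow> nat \<Rightarrow> (complex ^ 'd) set) \<Rightarrow> bool" where
  "smooth_family m a b H \<longleftrightarrow>
     (\<exists>\<alpha>. \<forall>i\<in>{1..m}. (\<forall>t\<in>{a<..<b}. defining_form (\<alpha> i t) (H t i)) \<and>
                     (\<forall>j. smooth_on {a<..<b} (\<lambda>t. \<alpha> i t $ j)))"

definition isotopy ::
    "nat \<Rightarrow> real \<Rightarrow> real \<Rightarrow> (real \<Rightarrow> nat \<Rightarrow> (complex ^ 'd) set) \<Rightarrow> bool" where
  "isotopy m a b H \<longleftrightarrow>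
     smooth_family m a b H \<and>
     (\<forall>s\<in>{a<..<b}. \<forall>t\<in>{a<..<b}. matroid_of m (H s) = matroid_of m (H t))"

definition isotopic ::
    "nat \<Rightarrow> (nat \<Rightarrow> (complex ^ 'd) set) \<Rightarrow> (nat \<Rightarrow> (complex ^ 'd) set) \<Rightarrow> bool" where
  "isotopic m A B \<longleftrightarrow>
     (\<exists>a b H. isotopy m a b H \<and>
        (\<exists>s\<in>{a<..<b}. \<exists>t\<in>{a<..<b}. \<forall>i\<in>{1..m}. H s i = A i \<and> H t i = B i))"

lemma defining_form_unique:
  fixes a b :: "complex ^ 'd"
  assumes "defining_form a H" "defining_form b H"
  shows "\<exists>c. c \<noteq> 0 \<and> b = c *s a"
proof -
  have ne: "a \<noteq> 0" "b \<noteq> 0" and eq: "\<And>x. lin_form a x = 0 \<longleftrightarrow> lin_form b x = 0"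
    using assms by (auto simp: defining_form_def set_eq_iff)
  obtain k where k: "a $ k \<noteq> 0"
    using ne(1) by (auto simp: vec_eq_iff)
  have *: "b $ j * a $ k = b $ k * a $ j" for j
  proof -
    define x where "x = a $ k *s axis j 1 - a $ j *s axis k (1 :: complex)"
    have axis: "lin_form v (axis i 1) = v $ i" for v and i :: 'd
      by (simp add: lin_form_def axis_def if_distrib cong: if_cong)
    have form: "lin_form v x = a $ k * v $ j - a $ j * v $ k" for v
    proof -
      have "lin_form v x = a $ k * lin_form v (axis j 1) - a $ j * lin_form v (axis k 1)"
        by (simp add: lin_form_def x_def sum_distrib_left sum_subtractf algebra_simps)
      then show ?thesis
        by (simp only: axis)
    qed
    have "lin_form a x = 0"
      by (simp add: form)
    then have "lin_form b x = 0"
      using eq by blast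
    then show ?thesis
      by (simp add: form algebra_simps)
  qed
  have "b = (b $ k / a $ k) *s a"
    using * k by (simp add: vec_eq_iff field_simps)
  moreover from this have "b $ k / a $ k \<noteq> 0"
    using ne(2) by (metis vec.scale_zero_left)
  ultimately show ?thesis
    by blast
qed

lemma lin_indep_family_cong:
  assumes "finite S" "lin_indep_family \<alpha> S"
    and "\<And>i. i \<in> S \<Longrightarrow> defining_form (\<alpha> i) (H i)" "\<And>i. i \<in> S \<Longrightarrow> defining_form (\<beta> i) (H i)"
  shows "lin_indep_family \<beta> S"
proof -
  have sub: "\<alpha> ` S \<subseteq> vec.span (\<beta> ` S)"
  proof
    fix v assume "v \<in> \<alpha> ` S"
    then obtain i where i: "i \<in> S" "v = \<alpha> i"
      by auto
    obtain c where "\<alpha> i = c *s \<beta> i"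
      using defining_form_unique assms(3,4) i by blast
    then show "v \<in> vec.span (\<beta> ` S)"
      using i by (simp add: vec.span_base vec.span_scale)
  qed
  have "card S = vec.dim (\<alpha> ` S)"
    using assms(2) by (simp add: lin_indep_family_def card_image vec.dim_eq_card_independent)
  also have "\<dots> \<le> vec.dim (\<beta> ` S)"
    using vec.dim_mono[OF sub] .
  finally have dim: "card S \<le> vec.dim (\<beta> ` S)" .
  have le: "vec.dim (\<beta> ` S) \<le> card (\<beta> ` S)"
    by (rule vec.dim_le_card) (auto simp: vec.span_base assms(1))
  have card: "card (\<beta> ` S) = card S"
    using dim le card_image_le[OF assms(1), of \<beta>] by linarith
  then have "inj_on \<beta> S"
    using assms(1) by (simp add: eq_card_imp_inj_on)
  moreover have "\<not> vec.dependent (\<beta> ` S)"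
    by (rule vec.card_le_dim_spanning[where V = "\<beta> ` S"])
       (auto simp: vec.span_base assms(1) card dim)
  ultimately show ?thesis
    by (simp add: lin_indep_family_def)
qed

lemma matroid_of_iff:
  assumes "\<And>i. i \<in> {1..m} \<Longrightarrow> defining_form (\<alpha> i) (H i)"
  shows "S \<in> matroid_of m H \<longleftrightarrow> S \<subseteq> {1..m} \<and> lin_indep_family \<alpha> S"
proof
  assume "S \<in> matroid_of m H"
  then obtain \<beta> where S: "S \<subseteq> {1..m}" and \<beta>: "\<And>i. i \<in> S \<Longrightarrow> defining_form (\<beta> i) (H i)"
      and ind: "lin_indep_family \<beta> S"
    unfolding matroid_of_def by blast
  have "lin_indep_family \<alpha> S"
    using S \<beta> assms by (intro lin_indep_family_cong[OF finite_subset[OF S] ind]) auto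
  with S show "S \<subseteq> {1..m} \<and> lin_indep_family \<alpha> S"
    by blast
next
  assume "S \<subseteq> {1..m} \<and> lin_indep_family \<alpha> S"
  then show "S \<in> matroid_of m H"
    using assms unfolding matroid_of_def by blast
qed

end

theory Submission
  imports Defs
begin

text \<open>
  Any two realizations \<open>\<alpha>\<close>, \<open>\<beta>\<close> of the matroid are joined by a polynomial family \<open>q\<close> over
  \<open>\<complex>\<close> with \<open>q 0 = \<alpha>\<close> and \<open>q 1 = \<beta>\<close> along which dependent sets stay dependent.  Independence
  is an open condition that holds at \<open>0\<close>, so the matroid changes only at finitely many parameters,
  and a smooth real curve from \<open>0\<close> to \<open>1\<close> avoids these.

  In rank 3, regard the vectors as points of the projective plane.  Zero and parallel vectors are
  harmless.  If a point lies on at most two lines containing two further points, the family for the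
  remaining points extends to it: the point is free, moves on one line, or is the intersection of
  two lines.  If there is no such point among at most seven, then each point lies on exactly three
  lines with three points each, so the configuration is the Fano plane, which does not exist in
  characteristic 0.  For at most seven elements either the rank or the corank is at most 3, and
  Gale duality exchanges the two.
\<close>

subsection \<open>Determinants and parallel vectors in dimension 3\<close>

text \<open>The obstacle is degeneration along the family: two points spanning a line may become
  parallel at some parameter, and a point found by dividing would then be lost. Hence the moving
  points are given without division, and dependences are kept as identities over the polynomial
  ring; a formula that is correct at 0 and 1 is admissible however much collapses in between. The
  duality step follows the same rule: Cramer's rule replaces the inverse of a basis, and its
  denominator is a polynomial equal to 1 at both ends.

  The bound seven matters in the plane because three lines through a point, each with two further
  points, require six of these. Then every pair of points has exactly one third point on its line,
  and the coordinates of such a system force twice a nonzero number to be 0.\<close>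

definition det3 :: "(3 \<Rightarrow> 'a::comm_ring_1) \<Rightarrow> (3 \<Rightarrow> 'a) \<Rightarrow> (3 \<Rightarrow> 'a) \<Rightarrow> 'a" where
  "det3 a b c = a 1 * (b 2 * c 3 - b 3 * c 2) - a 2 * (b 1 * c 3 - b 3 * c 1)
    + a 3 * (b 1 * c 2 - b 2 * c 1)"

text \<open>Vanishing of all 2x2 minors, so the zero vector is parallel to everything. Like
  \<open>det3\<close> it avoids division and serves for vectors of numbers and of polynomials
  alike.\<close>

definition par :: "(3 \<Rightarrow> 'a::comm_ring_1) \<Rightarrow> (3 \<Rightarrow> 'a) \<Rightarrow> bool" where
  "par a b \<longleftrightarrow> (\<forall>k l. a k * b l = a l * b k)"

lemma par_3: "par a b \<longleftrightarrow> a 1 * b 2 = a 2 * b 1 \<and> a 1 * b 3 = a 3 * b 1 \<and> a 2 * b 3 = a 3 * b 2"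
  unfolding par_def forall_3 by (auto simp: mult.commute)

lemma par_sym: "par a b \<longleftrightarrow> par b a"
  by (auto simp: par_3 mult.commute)

lemma det3_swap12: "det3 b a c = - det3 a b c" by (simp add: det3_def algebra_simps)

lemma det3_swap23: "det3 a c b = - det3 a b c" by (simp add: det3_def algebra_simps)

lemma det3_rot: "det3 b c a = det3 a b c" by (simp add: det3_def algebra_simps)

lemma det3_same [simp]: "det3 a a b = 0" "det3 a b b = 0" "det3 a b a = 0"
  by (simp_all add: det3_def algebra_simps)

lemma det3_scale: "det3 (\<lambda>k. r * a k) (\<lambda>k. s * b k) (\<lambda>k. t * c k) = r * s * t * det3 a b c"
  by (simp add: det3_def algebra_simps)

lemma det3_comb: "det3 (\<lambda>k. s * a k + t * b k) c d = s * det3 a c d + t * det3 b c d"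
  by (simp add: det3_def algebra_simps)

lemma par_scale:
  fixes a b :: "3 \<Rightarrow> 'a::idom"
  assumes "r \<noteq> 0" "s \<noteq> 0"
  shows "par (\<lambda>k. r * a k) (\<lambda>k. s * b k) \<longleftrightarrow> par a b"
proof -
  have "r * a k * (s * b l) = r * a l * (s * b k) \<longleftrightarrow> a k * b l = a l * b k" for k l
  proof -
    have "r * a k * (s * b l) = (r * s) * (a k * b l)" "r * a l * (s * b k) = (r * s) * (a l * b k)"
      by (simp_all add: algebra_simps)
    then show ?thesis using assms by simp
  qed
  then show ?thesis unfolding par_def by blast
qed

lemma par_scaleI: "par a b \<Longrightarrow> par (\<lambda>k. r * a k) (\<lambda>k. s * b k)"
  unfolding par_def by (metis (no_types, opaque_lifting) mult.left_commute mult.assoc)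

lemma poly_det3: "poly (det3 a b c) z = det3 (\<lambda>k. poly (a k) z) (\<lambda>k. poly (b k) z) (\<lambda>k. poly (c k) z)"
  by (simp add: det3_def)

lemma poly_par: "par a b \<Longrightarrow> par (\<lambda>k. poly (a k) z) (\<lambda>k. poly (b k) z)"
  unfolding par_def by (metis poly_mult)

text \<open>Both \<open>f\<close> and \<open>k\<close> lie on the line through \<open>e\<close> and
  \<open>h\<close>, a genuine line because these two are not parallel. With rotated arguments this
  makes being on one line with a fixed point transitive.\<close>

lemma det3_trans:
  fixes e f h k :: "3 \<Rightarrow> 'a::idom"
  assumes "det3 e f h = 0" "det3 e h k = 0" "\<not> par e h"
  shows "det3 f h k = 0"
proof -
  \<comment> \<open>A Pluecker relation; multiplying by a nonzero minor of \<open>e\<close> and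
    \<open>h\<close> replaces division.\<close>
  have *: "det3 f h k * (e i * h j - e j * h i) =
      det3 e h k * (f i * h j - f j * h i) - det3 e f h * (h i * k j - h j * k i)" for i j
    unfolding det3_def by (insert exhaust_3[of i] exhaust_3[of j], elim disjE) (simp_all add: algebra_simps)
  obtain i j where "e i * h j - e j * h i \<noteq> 0" using assms(3) unfolding par_def by auto
  with *[of i j] assms show ?thesis by simp
qed

lemma det3_span2:
  fixes e f g :: "3 \<Rightarrow> 'a::field"
  assumes "det3 e f g = 0" "\<not> par f g"
  obtains s t where "e = (\<lambda>k. s * f k + t * g k)"
proof -
  obtain i j where ij: "f i * g j - f j * g i \<noteq> 0" using assms(2) unfolding par_def by auto
  define d where "d = f i * g j - f j * g i"
  have *: "d * e k = (e i * g j - e j * g i) * f k + (f i * e j - f j * e i) * g k" for k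
  proof -
    \<comment> \<open>The sign of the permutation \<open>(i, j, k)\<close>, or 0 if an index
      repeats: the two sides of the claim differ by this multiple of the determinant.\<close>
    define \<epsilon> :: 'a where "\<epsilon> = (if (i, j, k) \<in> {(1, 2, 3), (2, 3, 1), (3, 1, 2)} then 1
      else if (i, j, k) \<in> {(2, 1, 3), (3, 2, 1), (1, 3, 2)} then -1 else 0)"
    have "d * e k - ((e i * g j - e j * g i) * f k + (f i * e j - f j * e i) * g k) = \<epsilon> * det3 e f g"
      unfolding det3_def d_def \<epsilon>_def
      by (insert exhaust_3[of i] exhaust_3[of j] exhaust_3[of k], elim disjE) (simp_all add: algebra_simps)
    then show ?thesis using assms(1) by simp
  qed
  have "e k = (e i * g j - e j * g i) / d * f k + (f i * e j - f j * e i) / d * g k" for k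
  proof -
    have "e k = ((e i * g j - e j * g i) * f k + (f i * e j - f j * e i) * g k) / d"
      using ij[folded d_def] by (simp add: *[of k, symmetric])
    then show ?thesis by (simp add: add_divide_distrib)
  qed
  then show ?thesis using that by blast
qed

text \<open>Both sides expand the double cross product (f x g) x (f' x g'), the meeting point of two
  lines, once in terms of \<open>f\<close>, \<open>g\<close> and once in terms of \<open>f'\<close>,
  \<open>g'\<close>.\<close>

lemma det3_meet:
  "det3 f f' g' * g k - det3 g f' g' * f k = det3 f g g' * f' k - det3 f g f' * g' k"
  unfolding det3_def by (insert exhaust_3[of k], elim disjE) (simp_all add: algebra_simps)

text \<open>The nonzero determinant separates the two lines, so their only common point is the one
  of \<open>det3_meet\<close>. Only the scalar \<open>c\<close> is left free, and it can be
  interpolated.\<close>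

lemma det3_meet_point:
  fixes e f g f' g' :: "3 \<Rightarrow> 'a::field"
  assumes "det3 e f g = 0" "det3 e f' g' = 0" "det3 e f f' \<noteq> 0" "\<not> par f g" "\<not> par f' g'"
  obtains c where "e = (\<lambda>k. c * (det3 f f' g' * g k - det3 g f' g' * f k))"
proof -
  obtain s t where e: "e = (\<lambda>k. s * f k + t * g k)" using det3_span2 assms by blast
  have x: "det3 f f' g' \<noteq> 0"
  proof
    assume "det3 f f' g' = 0"
    then have 1: "det3 g' f f' = 0" by (metis det3_rot)
    have 2: "det3 g' f' e = 0" using assms(2) by (metis det3_rot det3_swap12 neg_equal_0_iff_equal)
    have "\<not> par g' f'" using assms(5) par_sym by blast
    from det3_trans[OF 1 2 this] assms(3) show False by (metis det3_rot)
  qed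
  have "s * det3 f f' g' + t * det3 g f' g' = 0" using assms(2) unfolding e det3_comb .
  then have s: "s = - t * det3 g f' g' / det3 f f' g'" using x by (simp add: field_simps eq_neg_iff_add_eq_0)
  have "e = (\<lambda>k. (t / det3 f f' g') * (det3 f f' g' * g k - det3 g f' g' * f k))"
    unfolding e s using x by (auto simp: fun_eq_iff field_simps)
  then show ?thesis using that by blast
qed

lemma par_nonzero:
  fixes e f :: "3 \<Rightarrow> 'a::field"
  assumes "par e f" "f \<noteq> (\<lambda>_. 0)"
  obtains a where "e = (\<lambda>k. a * f k)"
proof -
  obtain j where "f j \<noteq> 0" using assms(2) by auto
  then have "e = (\<lambda>k. e j / f j * f k)" using assms(1) by (auto simp: par_def fun_eq_iff field_simps)
  then show ?thesis using that by blast
qed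

subsection \<open>The Fano plane\<close>

text \<open>Four of the lines express \<open>c\<close>, \<open>e\<close>, \<open>f\<close>,
  \<open>g\<close> by two coefficients each, the other three give equations between these. After
  multiplication by \<open>g1 * g2\<close>, two equations make the summands of the third equal, so
  twice a nonzero product vanishes.\<close>

lemma fano_not_complex:
  fixes a b c d e f g :: "3 \<Rightarrow> complex"
  assumes "det3 a b d \<noteq> 0"
    and "det3 a b c = 0" "det3 a d e = 0" "det3 a f g = 0"
    and "det3 b d f = 0" "det3 b e g = 0" "det3 c d g = 0" "det3 c e f = 0"
    and np: "\<not> par a c" "\<not> par b c" "\<not> par a e" "\<not> par d e" "\<not> par b f" "\<not> par d f"
      "\<not> par c d" "\<not> par a f" "\<not> par b e" "\<not> par c g" "\<not> par d g"
      "\<not> par a b" "\<not> par a d" "\<not> par b d"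
  shows False
proof -
  have "det3 c a b = 0" "det3 e a d = 0" "det3 f b d = 0" "det3 g c d = 0"
    using assms by (metis det3_rot)+
  then obtain c1 c2 e1 e2 f1 f2 g1 g2 where
    ex: "c = (\<lambda>k. c1 * a k + c2 * b k)" "e = (\<lambda>k. e1 * a k + e2 * d k)"
    "f = (\<lambda>k. f1 * b k + f2 * d k)" "g = (\<lambda>k. g1 * c k + g2 * d k)"
    using np by (metis (no_types, lifting) det3_span2)
  define D where "D = det3 a b d"
  have D: "D \<noteq> 0" using assms(1) by (simp add: D_def)
  have "det3 a f g = D * (f1 * g2 - f2 * g1 * c2)"
    unfolding D_def ex by (simp add: det3_def algebra_simps)
  then have 1: "f1 * g2 = f2 * g1 * c2" using assms D by simp
  have "det3 b e g = - (D * (e1 * g2 - e2 * g1 * c1))"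
    unfolding D_def ex by (simp add: det3_def algebra_simps)
  then have 2: "e1 * g2 = e2 * g1 * c1" using assms D by simp
  have "det3 c e f = - (D * (c1 * e2 * f1 + c2 * e1 * f2))"
    unfolding D_def ex by (simp add: det3_def algebra_simps)
  then have 3: "c1 * e2 * f1 + c2 * e1 * f2 = 0" using assms D by simp
  have "g1 * g2 * (c1 * e2 * f1 + c2 * e1 * f2) = 2 * g2 * g2 * e1 * f1"
    using 1 2 by algebra
  then have z: "g2 = 0 \<or> e1 = 0 \<or> f1 = 0" using 3 by auto
  \<comment> \<open>A zero coefficient would make \<open>g\<close> parallel to \<open>c\<close>, or
    \<open>e\<close> or \<open>f\<close> parallel to \<open>d\<close>.\<close>
  have "g2 \<noteq> 0" using np unfolding ex par_def by (auto simp: algebra_simps)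
  moreover have "e1 \<noteq> 0" using np unfolding ex(2) par_def by (auto simp: algebra_simps)
  moreover have "f1 \<noteq> 0" using np unfolding ex(3) par_def by (auto simp: algebra_simps)
  ultimately show False using z by blast
qed

text \<open>The lines through each point split the other six into three pairs, so any two points
  have exactly one third point on their line: a Steiner triple system on seven points, and that is
  the Fano plane.\<close>

lemma no_fano_configuration:
  fixes v :: "'i \<Rightarrow> 3 \<Rightarrow> complex"
  assumes np: "\<And>i j. \<lbrakk>i \<in> E; j \<in> E; i \<noteq> j\<rbrakk> \<Longrightarrow> \<not> par (v i) (v j)"
    and "E \<noteq> {}"
    and lines: "\<And>e. e \<in> E \<Longrightarrow> \<exists>f g f' g' f'' g''. distinct [e, f, g, f', g', f'', g''] \<and>
      E = {e, f, g, f', g', f'', g''} \<and> det3 (v e) (v f) (v g) = 0 \<and>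
      det3 (v e) (v f') (v g') = 0 \<and> det3 (v e) (v f'') (v g'') = 0 \<and>
      det3 (v e) (v f) (v f') \<noteq> 0 \<and> det3 (v e) (v f) (v f'') \<noteq> 0 \<and> det3 (v e) (v f') (v f'') \<noteq> 0"
  shows False
proof -
  define C where "C x y z \<longleftrightarrow> x \<in> E \<and> y \<in> E \<and> z \<in> E \<and> distinct [x, y, z] \<and> det3 (v x) (v y) (v z) = 0"
    for x y z
  have rot: "C x y z \<Longrightarrow> C y z x" and swap: "C x y z \<Longrightarrow> C y x z" for x y z
    unfolding C_def by (auto simp: det3_rot) (metis det3_swap12 neg_equal_0_iff_equal)
  have uniq: "y = z" if "C e x y" "C e x z" for e x y z
  proof (rule ccontr)
    assume ne: "y \<noteq> z"
    have eE: "e \<in> E" using that C_def by blast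
    obtain f g f' g' f'' g'' where *: "distinct [e, f, g, f', g', f'', g'']"
      "E = {e, f, g, f', g', f'', g''}" "det3 (v e) (v f) (v g) = 0"
      "det3 (v e) (v f') (v g') = 0" "det3 (v e) (v f'') (v g'') = 0"
      "det3 (v e) (v f) (v f') \<noteq> 0" "det3 (v e) (v f) (v f'') \<noteq> 0" "det3 (v e) (v f') (v f'') \<noteq> 0"
      using lines[OF eE] by blast
    \<comment> \<open>For points other than \<open>e\<close>, collinearity with \<open>e\<close> is
      an equivalence relation whose classes are the three pairs; \<open>k\<close> below chooses
      representatives. A second third point would put three points into a class of two.\<close>
    define R where "R p q \<longleftrightarrow> det3 (v e) (v p) (v q) = 0" for p q
    have Rs: "R p q \<Longrightarrow> R q p" for p q unfolding R_def by (metis det3_swap23 neg_equal_0_iff_equal)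
    have Rt: "R p q \<Longrightarrow> R q r \<Longrightarrow> R p r" if "q \<in> E" "q \<noteq> e" for p q r
    proof -
      assume a: "R p q" "R q r"
      have "\<not> par (v q) (v e)" using np that eE by auto
      moreover have "det3 (v q) (v r) (v e) = 0" "det3 (v q) (v e) (v p) = 0"
        using a unfolding R_def by (metis det3_rot)+
      ultimately have "det3 (v r) (v e) (v p) = 0"
        using det3_trans by blast
      then show ?thesis unfolding R_def by (metis det3_rot)
    qed
    have R: "R f g" "R f' g'" "R f'' g''" "\<not> R f f'" "\<not> R f f''" "\<not> R f' f''"
      using * unfolding R_def by auto
    have xyz: "R x y" "R x z" "x \<in> E" "y \<in> E" "z \<in> E" "x \<noteq> e" "y \<noteq> e" "z \<noteq> e" "x \<noteq> y" "x \<noteq> z"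
      using that unfolding R_def C_def by auto
    have f: "f \<in> E" "f' \<in> E" "f'' \<in> E" "g \<in> E" "g' \<in> E" "g'' \<in> E"
      "f \<noteq> e" "f' \<noteq> e" "f'' \<noteq> e" "g \<noteq> e" "g' \<noteq> e" "g'' \<noteq> e" using * by auto
    define k where "k p = (if p \<in> {f, g} then f else if p \<in> {f', g'} then f' else f'')" for p
    have k: "R p (k p)" "k p \<in> {f, f', f''}" if "p \<in> E" "p \<noteq> e" for p
    proof -
      have refl: "R q q" for q by (simp add: R_def)
      have "p \<in> {f, g, f', g', f'', g''}" using that unfolding *(2) by blast
      then show "R p (k p)" using refl R(1-3)[THEN Rs] by (auto simp: k_def)
      show "k p \<in> {f, f', f''}" by (simp add: k_def)
    qed
    have kE: "k p \<in> E" "k p \<noteq> e" if "p \<in> E" "p \<noteq> e" for p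
      using k(2)[OF that] f by auto
    have kR: "k p = k q" if "R p q" "p \<in> E" "p \<noteq> e" "q \<in> E" "q \<noteq> e" for p q
    proof -
      have "R (k p) (k q)" using that k[of p] k[of q] Rt Rs kE by metis
      then show ?thesis using k(2)[of p] k(2)[of q] that R Rs by auto
    qed
    have "k x = k y" "k x = k z" using kR[of x y] kR[of x z] xyz by blast+
    then show False using xyz(3-) ne *(1) unfolding *(2) k_def by (auto split: if_splits)
  qed
  obtain a where a: "a \<in> E" using \<open>E \<noteq> {}\<close> by auto
  obtain b c d e f g where di: "distinct [a, b, c, d, e, f, g]" and E: "E = {a, b, c, d, e, f, g}"
    and "det3 (v a) (v b) (v c) = 0" "det3 (v a) (v d) (v e) = 0" "det3 (v a) (v f) (v g) = 0"
    using lines[OF a] by metis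
  then have abc: "C a b c" and ade: "C a d e" and afg: "C a f g" by (auto simp: C_def)
  have third: "\<exists>z. C x y z" if xy: "x \<in> E" "y \<in> E" "x \<noteq> y" for x y
  proof -
    obtain f g f' g' f'' g'' where *: "distinct [x, f, g, f', g', f'', g'']"
      "E = {x, f, g, f', g', f'', g''}" "det3 (v x) (v f) (v g) = 0"
      "det3 (v x) (v f') (v g') = 0" "det3 (v x) (v f'') (v g'') = 0"
      using lines[OF xy(1)] by metis
    have "C x f g" "C x f' g'" "C x f'' g''" using * by (auto simp: C_def)
    moreover have "C x z y" if "C x y z" for y z using rot[OF swap[OF that]] .
    moreover have "y \<in> {f, g, f', g', f'', g''}" using xy(2,3) unfolding *(2) by blast
    ultimately show ?thesis by blast
  qed
  have CE: "C x y z \<Longrightarrow> x \<in> {a,b,c,d,e,f,g} \<and> y \<in> {a,b,c,d,e,f,g} \<and> z \<in> {a,b,c,d,e,f,g} \<and> x \<noteq> y \<and> y \<noteq> z \<and> x \<noteq> z"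
    for x y z unfolding C_def E by simp
  have U: "z \<in> {p, q, r}" if xyz: "C x y z" and pqr: "C p q r" and xy: "x \<in> {p, q, r}" "y \<in> {p, q, r}"
    for x y z p q r
  proof -
    have "x \<noteq> y" using xyz by (simp add: C_def)
    note pqr rot[OF pqr] rot[OF rot[OF pqr]] swap[OF pqr] rot[OF swap[OF pqr]] rot[OF rot[OF swap[OF pqr]]]
    with \<open>x \<noteq> y\<close> xy obtain s where "C x y s" "s \<in> {p, q, r}" by blast
    then show ?thesis using uniq[OF xyz] by blast
  qed
  \<comment> \<open>One line besides the three through \<open>a\<close> fixes the rest: each further
    third point is found by excluding the points on known lines. The names \<open>f\<close> and
    \<open>g\<close> are bound anew, since the third point on the line \<open>b d\<close> may be
    either and the cases differ by exchanging them.\<close>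
  have key: False if di: "distinct [a, b, c, d, e, f, g]" and E': "E = {a, b, c, d, e, f, g}"
     and abc: "C a b c" and ade: "C a d e" and afg: "C a f g" and bdf: "C b d f" for f g
  proof -
    have CE: "C x y z \<Longrightarrow> x \<in> {a,b,c,d,e,f,g} \<and> y \<in> {a,b,c,d,e,f,g} \<and> z \<in> {a,b,c,d,e,f,g} \<and> x \<noteq> y \<and> y \<noteq> z \<and> x \<noteq> z"
      for x y z unfolding C_def E' by simp
    have ne: "b \<noteq> e" "c \<noteq> d" "c \<noteq> e" using di by auto
    obtain z where z: "C b e z" using third[of b e] ne E' by blast
    have "z \<notin> {a, b, c}" using U[OF rot[OF rot[OF z]] abc] di by auto
    moreover have "z \<notin> {a, d, e}" using U[OF rot[OF z] ade] di by auto
    moreover have "z \<notin> {b, d, f}" using U[OF rot[OF rot[OF z]] bdf] di by auto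
    ultimately have beg: "C b e g" using CE[OF z] z by blast
    obtain z where z: "C c d z" using third[of c d] ne E' by blast
    have "z \<notin> {a, b, c}" using U[OF rot[OF rot[OF z]] abc] di by auto
    moreover have "z \<notin> {a, d, e}" using U[OF rot[OF z] ade] di by auto
    moreover have "z \<notin> {b, d, f}" using U[OF rot[OF z] bdf] di by auto
    ultimately have cdg: "C c d g" using CE[OF z] z by blast
    obtain z where z: "C c e z" using third[of c e] ne E' by blast
    have "z \<notin> {a, b, c}" using U[OF rot[OF rot[OF z]] abc] di by auto
    moreover have "z \<notin> {a, d, e}" using U[OF rot[OF z] ade] di by auto
    moreover have "z \<notin> {b, e, g}" using U[OF rot[OF z] beg] di by auto
    ultimately have cef: "C c e f" using CE[OF z] z by blast
    have "\<not> C a b d" using U[of a b d a b c] abc di by auto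
    then have "det3 (v a) (v b) (v d) \<noteq> 0" using di E' by (auto simp: C_def)
    then show False
      using fano_not_complex[of "v a" "v b" "v d" "v c" "v e" "v f" "v g"] np di E'
        abc ade afg bdf beg cdg cef by (auto simp: C_def)
  qed
  have "b \<noteq> d" using di by auto
  then obtain z where z: "C b d z" using third[of b d] E by blast
  have "z \<notin> {a, b, c}" using U[OF rot[OF rot[OF z]] abc] di by auto
  moreover have "z \<notin> {a, d, e}" using U[OF rot[OF z] ade] di by auto
  ultimately have "z = f \<or> z = g" using CE[OF z] by blast
  then show False
  proof
    assume "z = f"
    then show False using key[OF di E abc ade afg] z by blast
  next
    assume "z = g"
    with z have "C b d g" by simp
    moreover have "distinct [a, b, c, d, e, g, f]" using di by auto
    moreover have "E = {a, b, c, d, e, g, f}" using E by auto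
    ultimately show False using key[of g f] abc ade rot[OF swap[OF afg]] by blast
  qed
qed

subsection \<open>Polynomial families in dimension 3\<close>

definition lin :: "complex \<Rightarrow> complex \<Rightarrow> complex poly" where
  "lin a b = [:a, b - a:]"

lemma poly_lin [simp]: "poly (lin a b) 0 = a" "poly (lin a b) 1 = b"
  by (simp_all add: lin_def)

text \<open>Only degeneracies are prescribed, and as polynomial identities, hence at all parameters;
  further ones may appear at some. The three kinds are the dependences of one, two and three
  vectors, compare \<open>dep_transfer\<close>.\<close>

definition lift3 :: "('i \<Rightarrow> 3 \<Rightarrow> complex) \<Rightarrow> ('i \<Rightarrow> 3 \<Rightarrow> complex) \<Rightarrow> 'i set \<Rightarrow> ('i \<Rightarrow> 3 \<Rightarrow> complex poly) \<Rightarrow> bool" where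
  "lift3 v w E p \<longleftrightarrow> (\<forall>i\<in>E. \<forall>k. poly (p i k) 0 = v i k \<and> poly (p i k) 1 = w i k) \<and>
    (\<forall>i\<in>E. v i = (\<lambda>_. 0) \<longrightarrow> p i = (\<lambda>_. 0)) \<and>
    (\<forall>i\<in>E. \<forall>j\<in>E. par (v i) (v j) \<longrightarrow> par (p i) (p j)) \<and>
    (\<forall>i\<in>E. \<forall>j\<in>E. \<forall>k\<in>E. det3 (v i) (v j) (v k) = 0 \<longrightarrow> det3 (p i) (p j) (p k) = 0)"

definition same3 :: "('i \<Rightarrow> 3 \<Rightarrow> complex) \<Rightarrow> ('i \<Rightarrow> 3 \<Rightarrow> complex) \<Rightarrow> 'i set \<Rightarrow> bool" where
  "same3 v w E \<longleftrightarrow> (\<forall>i\<in>E. v i = (\<lambda>_. 0) \<longleftrightarrow> w i = (\<lambda>_. 0)) \<and>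
    (\<forall>i\<in>E. \<forall>j\<in>E. par (v i) (v j) \<longleftrightarrow> par (w i) (w j)) \<and>
    (\<forall>i\<in>E. \<forall>j\<in>E. \<forall>k\<in>E. det3 (v i) (v j) (v k) = 0 \<longleftrightarrow> det3 (w i) (w j) (w k) = 0)"

lemma par_zero [simp]: "par (\<lambda>_. 0) a" "par a (\<lambda>_. 0)"
  by (simp_all add: par_def)

lemma det3_zero [simp]: "det3 (\<lambda>_. 0) a b = 0" "det3 a (\<lambda>_. 0) b = 0" "det3 a b (\<lambda>_. 0) = 0"
  by (simp_all add: det3_def)

section \<open>Extending a polynomial family by one point\<close>

lemma lift3_insert_zero:
  assumes "lift3 v w (E - {e}) p" "v e = (\<lambda>_. 0)" "w e = (\<lambda>_. 0)"
  shows "lift3 v w E (p(e := (\<lambda>_. 0)))"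
  using assms unfolding lift3_def by auto

text \<open>The element \<open>e\<close> follows \<open>f\<close>, with a scalar that moves from
  \<open>a\<close> to \<open>b\<close>. If the scalar vanishes somewhere, this only adds
  degeneracies.\<close>

lemma lift3_insert_parallel:
  assumes p: "lift3 v w (E - {e}) p" and f: "f \<in> E" "f \<noteq> e"
    and par: "par (v e) (v f)" "par (w e) (w f)"
    and nz: "v e \<noteq> (\<lambda>_. 0)" "v f \<noteq> (\<lambda>_. 0)" "w f \<noteq> (\<lambda>_. 0)"
  shows "\<exists>p. lift3 v w E p"
proof -
  obtain a b where a: "v e = (\<lambda>k. a * v f k)" and b: "w e = (\<lambda>k. b * w f k)"
    using par nz par_nonzero by metis
  have "a \<noteq> 0" using a nz by auto
  \<comment> \<open>Replacing \<open>e\<close> by \<open>f\<close> and splitting off scalars reduces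
    each condition to \<open>E - {e}\<close>; \<open>r\<close> is cancelled and must not vanish,
    whereas \<open>s\<close> is only multiplied in.\<close>
  define \<tau> where "\<tau> i = (if i = e then f else i)" for i
  define r where "r i = (if i = e then a else 1)" for i
  define s where "s i = (if i = e then lin a b else 1)" for i
  define P where "P i = (\<lambda>k. s i * p (\<tau> i) k)" for i
  have r: "r i \<noteq> 0" "v i = (\<lambda>k. r i * v (\<tau> i) k)" for i
    using a \<open>a \<noteq> 0\<close> by (simp_all add: r_def \<tau>_def)
  have \<tau>: "\<tau> i \<in> E - {e}" if "i \<in> E" for i using that f by (auto simp: \<tau>_def)
  have "lift3 v w E P"
    unfolding lift3_def
  proof (intro conjI ballI impI allI)
    fix i k assume "i \<in> E"
    then have "poly (p (\<tau> i) k) 0 = v (\<tau> i) k" "poly (p (\<tau> i) k) 1 = w (\<tau> i) k"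
      using p \<tau> unfolding lift3_def by auto
    then show "poly (P i k) 0 = v i k" "poly (P i k) 1 = w i k"
      using a b by (auto simp: P_def s_def \<tau>_def)
  next
    fix i assume i: "i \<in> E" "v i = (\<lambda>_. 0)"
    then have "v (\<tau> i) = (\<lambda>_. 0)" using r[of i] by (auto simp: fun_eq_iff)
    then have "p (\<tau> i) = (\<lambda>_. 0)" using p \<tau>[OF i(1)] unfolding lift3_def by auto
    then show "P i = (\<lambda>_. 0)" by (simp add: P_def)
  next
    fix i j assume ij: "i \<in> E" "j \<in> E" "par (v i) (v j)"
    then have "par (v (\<tau> i)) (v (\<tau> j))" using r par_scale by metis
    then have "par (p (\<tau> i)) (p (\<tau> j))" using p \<tau> ij unfolding lift3_def by auto
    then show "par (P i) (P j)" unfolding P_def by (rule par_scaleI)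
  next
    fix i j k assume ij: "i \<in> E" "j \<in> E" "k \<in> E" "det3 (v i) (v j) (v k) = 0"
    have "r i * r j * r k * det3 (v (\<tau> i)) (v (\<tau> j)) (v (\<tau> k)) = 0"
      using ij(4) by (subst det3_scale[symmetric]) (simp add: r(2)[symmetric])
    then have "det3 (v (\<tau> i)) (v (\<tau> j)) (v (\<tau> k)) = 0" using r(1) by simp
    then have "det3 (p (\<tau> i)) (p (\<tau> j)) (p (\<tau> k)) = 0" using p \<tau> ij unfolding lift3_def by auto
    then show "det3 (P i) (P j) (P k) = 0" unfolding P_def det3_scale by simp
  qed
  then show ?thesis by blast
qed

text \<open>Among nonzero, pairwise nonparallel vectors a new one is constrained only by the lines
  through it, since determinants with a repeated entry vanish.\<close>

lemma lift3_insert: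
  assumes p: "lift3 v w (E - {e}) p" and e: "e \<in> E"
    and nz: "\<And>i. i \<in> E \<Longrightarrow> v i \<noteq> (\<lambda>_. 0)"
    and np: "\<And>i j. \<lbrakk>i \<in> E; j \<in> E; i \<noteq> j\<rbrakk> \<Longrightarrow> \<not> par (v i) (v j)"
    and u: "\<And>k. poly (u k) 0 = v e k" "\<And>k. poly (u k) 1 = w e k"
    and line: "\<And>f g. \<lbrakk>f \<in> E - {e}; g \<in> E - {e}; f \<noteq> g; det3 (v e) (v f) (v g) = 0\<rbrakk> \<Longrightarrow>
       det3 u (p f) (p g) = 0"
  shows "lift3 v w E (p(e := u))"
  unfolding lift3_def
proof (intro conjI ballI impI allI)
  fix i k assume "i \<in> E"
  then show "poly ((p(e := u)) i k) 0 = v i k" "poly ((p(e := u)) i k) 1 = w i k"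
    using p u unfolding lift3_def by auto
next
  fix i assume "i \<in> E" "v i = (\<lambda>_. 0)"
  then show "(p(e := u)) i = (\<lambda>_. 0)" using nz by blast
next
  fix i j assume "i \<in> E" "j \<in> E" "par (v i) (v j)"
  then have "i = j" using np by blast
  then show "par ((p(e := u)) i) ((p(e := u)) j)" by (simp add: par_def)
next
  let ?P = "p(e := u)"
  have old: "det3 (p i) (p j) (p k) = 0"
    if "i \<in> E - {e}" "j \<in> E - {e}" "k \<in> E - {e}" "det3 (v i) (v j) (v k) = 0" for i j k
    using p that unfolding lift3_def by blast
  have at_e: "det3 (?P e) (?P j) (?P k) = 0"
    if "j \<in> E" "k \<in> E" "det3 (v e) (v j) (v k) = 0" for j k
    using line[of j k] that by (cases "j = k \<or> j = e \<or> k = e") auto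
  fix i j k assume ijk: "i \<in> E" "j \<in> E" "k \<in> E" "det3 (v i) (v j) (v k) = 0"
  consider "i = e" | "j = e" | "k = e" | "i \<noteq> e" "j \<noteq> e" "k \<noteq> e" by blast
  then show "det3 (?P i) (?P j) (?P k) = 0"
  proof cases
    case 1 then show ?thesis using at_e ijk by blast
  next
    case 2
    then have "det3 (v e) (v k) (v i) = 0" using ijk by (metis det3_rot)
    then have "det3 (?P e) (?P k) (?P i) = 0" using at_e ijk by blast
    then show ?thesis using 2 by (metis det3_rot)
  next
    case 3
    then have "det3 (v e) (v i) (v j) = 0" using ijk by (metis det3_rot)
    then have "det3 (?P e) (?P i) (?P j) = 0" using at_e ijk by blast
    then show ?thesis using 3 by (metis det3_rot)
  next
    case 4
    then show ?thesis using old ijk by auto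
  qed
qed

text \<open>The points \<open>f\<close>, \<open>f'\<close>, \<open>f''\<close> represent the lines;
  the nonzero determinants make the three lines different.\<close>

definition three_lines :: "('i \<Rightarrow> 3 \<Rightarrow> complex) \<Rightarrow> 'i set \<Rightarrow> 'i \<Rightarrow> bool" where
  "three_lines v E e \<longleftrightarrow> (\<exists>f g f' g' f'' g''. {f, g, f', g', f'', g''} \<subseteq> E - {e} \<and> f \<noteq> g \<and> f' \<noteq> g' \<and> f'' \<noteq> g'' \<and>
     det3 (v e) (v f) (v g) = 0 \<and> det3 (v e) (v f') (v g') = 0 \<and> det3 (v e) (v f'') (v g'') = 0 \<and>
     det3 (v e) (v f) (v f') \<noteq> 0 \<and> det3 (v e) (v f) (v f'') \<noteq> 0 \<and> det3 (v e) (v f') (v f'') \<noteq> 0)"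

text \<open>The cases are distinguished by the number of lines through \<open>e\<close> and at least two further points.\<close>

lemma lift3_insert_few_lines:
  assumes p: "lift3 v w (E - {e}) p" and e: "e \<in> E" and same: "same3 v w E"
    and nz: "\<And>i. i \<in> E \<Longrightarrow> v i \<noteq> (\<lambda>_. 0)"
    and np: "\<And>i j. \<lbrakk>i \<in> E; j \<in> E; i \<noteq> j\<rbrakk> \<Longrightarrow> \<not> par (v i) (v j)"
    and few: "\<not> three_lines v E e"
  shows "\<exists>p. lift3 v w E p"
proof -
  define col where "col f g \<longleftrightarrow> f \<in> E - {e} \<and> g \<in> E - {e} \<and> f \<noteq> g \<and> det3 (v e) (v f) (v g) = 0" for f g
  have p_det: "det3 (p i) (p j) (p k) = 0"
    if "i \<in> E - {e}" "j \<in> E - {e}" "k \<in> E - {e}" "det3 (v i) (v j) (v k) = 0" for i j k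
    using p that unfolding lift3_def by blast
  have vw: "det3 (w i) (w j) (w k) = 0 \<longleftrightarrow> det3 (v i) (v j) (v k) = 0" if "i \<in> E" "j \<in> E" "k \<in> E" for i j k
    using same that unfolding same3_def by blast
  have npw: "\<not> par (w i) (w j)" if "i \<in> E" "j \<in> E" "i \<noteq> j" for i j
    using same that np unfolding same3_def by blast
  have p0: "poly (p i k) 0 = v i k" "poly (p i k) 1 = w i k" if "i \<in> E - {e}" for i k
    using p that unfolding lift3_def by blast+
  have on_line: "det3 (p f) (p h) (p k) = 0"
    if "col h k" "f \<in> E - {e}" "det3 (v e) (v f) (v h) = 0" for f h k
  proof -
    have "det3 (v f) (v h) (v k) = 0"
      using that det3_trans[of "v e" "v f" "v h" "v k"] np e unfolding col_def by auto
    then show ?thesis using p_det that unfolding col_def by blast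
  qed
  \<comment> \<open>In \<open>v\<close> the points \<open>f\<close>, \<open>g\<close>,
    \<open>h\<close>, \<open>k\<close> are on one line through \<open>e\<close>, so
    \<open>p f\<close> and \<open>p g\<close> both satisfy the linear equation given by
    \<open>p h\<close> and \<open>p k\<close>, and so does each combination.\<close>
  have comb: "det3 (\<lambda>x. s * p f x + t * p g x) (p h) (p k) = 0"
    if "col f g" "col h k" "det3 (v e) (v f) (v h) = 0" for f g h k s t
  proof -
    have "det3 (v e) (v g) (v h) = 0"
    proof -
      have "\<not> par (v f) (v e)" using that np e unfolding col_def by auto
      moreover have "det3 (v f) (v h) (v e) = 0" "det3 (v f) (v e) (v g) = 0"
        using that unfolding col_def by (metis det3_rot det3_swap12 neg_equal_0_iff_equal)+
      ultimately have "det3 (v h) (v e) (v g) = 0" using det3_trans by blast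
      then show ?thesis by (metis det3_rot)
    qed
    then show ?thesis
      using on_line[of h k f] on_line[of h k g] that unfolding det3_comb col_def by simp
  qed
  have few': "det3 (v e) (v f') (v f'') = 0"
    if "col f g" "col f' g'" "col f'' g''" "det3 (v e) (v f) (v f') \<noteq> 0" "det3 (v e) (v f) (v f'') \<noteq> 0"
    for f g f' g' f'' g''
  proof (rule ccontr)
    assume "det3 (v e) (v f') (v f'') \<noteq> 0"
    with that have "three_lines v E e"
      unfolding three_lines_def col_def
      by (intro exI[of _ f] exI[of _ g] exI[of _ f'] exI[of _ g'] exI[of _ f''] exI[of _ g'']) simp
    with few show False by blast
  qed
  note ins = lift3_insert[OF p e nz np]
  consider "\<And>f g. \<not> col f g"
    | F G where "col F G" "\<And>h k. col h k \<Longrightarrow> det3 (v e) (v F) (v h) = 0"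
    | F G F' G' where "col F G" "col F' G'" "det3 (v e) (v F) (v F') \<noteq> 0"
      "\<And>h k. col h k \<Longrightarrow> det3 (v e) (v F) (v h) = 0 \<or> det3 (v e) (v F') (v h) = 0"
  proof (cases "\<exists>F G. col F G \<and> (\<forall>h k. col h k \<longrightarrow> det3 (v e) (v F) (v h) = 0)")
    case True
    then show ?thesis using that(2) by blast
  next
    case no_line: False
    show ?thesis
    proof (cases "\<exists>F G. col F G")
      case True
      then obtain F G F' G' where FG: "col F G" "col F' G'" "det3 (v e) (v F) (v F') \<noteq> 0"
        using no_line by blast
      show ?thesis using that(3)[OF FG] few'[OF FG(1,2) _ FG(3)] by blast
    qed (use that(1) in blast)
  qed
  then show ?thesis
  proof cases
    case 1
    have "lift3 v w E (p(e := \<lambda>k. lin (v e k) (w e k)))"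
      by (rule ins) (use 1 in \<open>auto simp: col_def\<close>)
    then show ?thesis by blast
  next
    case 2
    have FG: "F \<in> E - {e}" "G \<in> E - {e}" "F \<noteq> G" "det3 (v e) (v F) (v G) = 0" using 2(1) by (auto simp: col_def)
    have "det3 (w e) (w F) (w G) = 0" using vw FG e by auto
    obtain s t where st: "v e = (\<lambda>k. s * v F k + t * v G k)" using det3_span2[OF FG(4)] np FG by blast
    obtain s' t' where st': "w e = (\<lambda>k. s' * w F k + t' * w G k)"
      using det3_span2[OF \<open>det3 (w e) _ _ = 0\<close>] npw FG by blast
    \<comment> \<open>Interpolating the coefficients instead of the point keeps \<open>e\<close> on
      the moving line.\<close>
    have "lift3 v w E (p(e := \<lambda>k. lin s s' * p F k + lin t t' * p G k))"
    proof (rule ins)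
      fix k show "poly (lin s s' * p F k + lin t t' * p G k) 0 = v e k"
        "poly (lin s s' * p F k + lin t t' * p G k) 1 = w e k"
        using FG p0 by (simp_all add: st st')
    next
      fix h k assume "h \<in> E - {e}" "k \<in> E - {e}" "h \<noteq> k" "det3 (v e) (v h) (v k) = 0"
      then have "col h k" by (simp add: col_def)
      then show "det3 (\<lambda>k. lin s s' * p F k + lin t t' * p G k) (p h) (p k) = 0"
        using comb 2 by blast
    qed
    then show ?thesis by blast
  next
    case 3
    have FG: "F \<in> E - {e}" "G \<in> E - {e}" "F \<noteq> G" "det3 (v e) (v F) (v G) = 0"
      "F' \<in> E - {e}" "G' \<in> E - {e}" "F' \<noteq> G'" "det3 (v e) (v F') (v G') = 0"
      using 3(1,2) by (auto simp: col_def)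
    have FGw: "det3 (w e) (w F) (w G) = 0" "det3 (w e) (w F') (w G') = 0" "det3 (w e) (w F) (w F') \<noteq> 0"
      using vw FG e 3(3) by auto
    obtain c where c: "v e = (\<lambda>k. c * (det3 (v F) (v F') (v G') * v G k - det3 (v G) (v F') (v G') * v F k))"
      using det3_meet_point[OF FG(4,8) 3(3)] np FG by blast
    obtain c' where c': "w e = (\<lambda>k. c' * (det3 (w F) (w F') (w G') * w G k - det3 (w G) (w F') (w G') * w F k))"
      using det3_meet_point[OF FGw] npw FG by blast
    define u where "u = (\<lambda>k. lin c c' * (det3 (p F) (p F') (p G') * p G k - det3 (p G) (p F') (p G') * p F k))"
    \<comment> \<open>The point stays on the first line by \<open>u1\<close> and on the second by
      \<open>u2\<close>, which uses the other expansion in \<open>det3_meet\<close>. Neither needs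
      the two lines to remain distinct.\<close>
    have u1: "u = (\<lambda>k. (- lin c c' * det3 (p G) (p F') (p G')) * p F k + (lin c c' * det3 (p F) (p F') (p G')) * p G k)"
      by (simp add: u_def algebra_simps)
    have u2: "u = (\<lambda>k. (lin c c' * det3 (p F) (p G) (p G')) * p F' k + (- lin c c' * det3 (p F) (p G) (p F')) * p G' k)"
      unfolding u_def
      by (rule ext, subst det3_meet[of "p F" "p F'" "p G'" "p G"]) (simp add: algebra_simps)
    have "lift3 v w E (p(e := u))"
    proof (rule ins)
      fix k
      show "poly (u k) 0 = v e k"
        using p0 FG by (subst c) (simp add: u_def poly_det3)
      show "poly (u k) 1 = w e k"
        using p0 FG by (subst c') (simp add: u_def poly_det3)
    next
      fix h k assume "h \<in> E - {e}" "k \<in> E - {e}" "h \<noteq> k" "det3 (v e) (v h) (v k) = 0"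
      then have col: "col h k" by (simp add: col_def)
      from 3(4)[OF this] show "det3 u (p h) (p k) = 0"
      proof
        assume "det3 (v e) (v F) (v h) = 0"
        with comb[OF 3(1) col] show ?thesis unfolding u1 by blast
      next
        assume "det3 (v e) (v F') (v h) = 0"
        with comb[OF 3(2) col] show ?thesis unfolding u2 by blast
      qed
    qed
    then show ?thesis by blast
  qed
qed

text \<open>The elements of \<open>L\<close> lie on no line with two further points, so they may be added freely.\<close>

theorem lift3_exists:
  fixes v w :: "'i \<Rightarrow> 3 \<Rightarrow> complex"
  assumes "finite E" "card (E - L) \<le> 7" "same3 v w E"
    and "\<And>l f g. \<lbrakk>l \<in> L \<inter> E; f \<in> E - {l}; g \<in> E - {l}; det3 (v l) (v f) (v g) = 0\<rbrakk> \<Longrightarrow> par (v f) (v g)"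
  shows "\<exists>p. lift3 v w E p"
  using assms
proof (induction "card E" arbitrary: E rule: less_induct)
  case less
  note fin = less.prems(1) and seven = less.prems(2) and same = less.prems(3) and coloop = less.prems(4)
  have IH: "\<exists>p. lift3 v w (E - {e}) p" if "e \<in> E" for e
  proof (rule less.hyps)
    show "card (E - {e}) < card E" using that fin by (rule card_Diff1_less[rotated])
    have "card (E - {e} - L) \<le> card (E - L)" using fin by (intro card_mono) auto
    then show "card (E - {e} - L) \<le> 7" using seven by simp
    show "same3 v w (E - {e})" using same unfolding same3_def by blast
  qed (use fin coloop in auto)
  have zero_iff: "v i = (\<lambda>_. 0) \<longleftrightarrow> w i = (\<lambda>_. 0)" if "i \<in> E" for i
    using same that unfolding same3_def by blast
  show ?case
  proof (cases "E = {}")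
    case True
    then have "lift3 v w E p" for p by (simp add: lift3_def)
    then show ?thesis by blast
  next
    case False
    consider (zero) e where "e \<in> E" "v e = (\<lambda>_. 0)"
      | (par) e f where "e \<in> E" "f \<in> E" "f \<noteq> e" "par (v e) (v f)" "\<forall>i\<in>E. v i \<noteq> (\<lambda>_. 0)"
      | (simple) "\<And>i. i \<in> E \<Longrightarrow> v i \<noteq> (\<lambda>_. 0)" "\<And>i j. \<lbrakk>i \<in> E; j \<in> E; i \<noteq> j\<rbrakk> \<Longrightarrow> \<not> par (v i) (v j)"
      by metis
    then show ?thesis
    proof cases
      case zero
      then show ?thesis using IH lift3_insert_zero zero_iff by metis
    next
      case par
      obtain p where p: "lift3 v w (E - {e}) p" using IH par by blast
      have "par (w e) (w f)" using par same unfolding same3_def by blast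
      then show ?thesis
        using lift3_insert_parallel[OF p par(2,3,4)] par zero_iff by metis
    next
      case simple
      show ?thesis
      proof (rule ccontr)
        assume neg: "\<nexists>p. lift3 v w E p"
        have lines: "\<exists>f g f' g' f'' g''. distinct [e, f, g, f', g', f'', g''] \<and>
          {e, f, g, f', g', f'', g''} \<subseteq> E \<and> det3 (v e) (v f) (v g) = 0 \<and>
          det3 (v e) (v f') (v g') = 0 \<and> det3 (v e) (v f'') (v g'') = 0 \<and>
          det3 (v e) (v f) (v f') \<noteq> 0 \<and> det3 (v e) (v f) (v f'') \<noteq> 0 \<and> det3 (v e) (v f') (v f'') \<noteq> 0"
          if e: "e \<in> E" for e
        proof -
          obtain p where p: "lift3 v w (E - {e}) p" using IH e by blast
          have "three_lines v E e" using lift3_insert_few_lines[OF p e same simple] neg by blast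
          then obtain f g f' g' f'' g'' where E: "{f, g, f', g', f'', g''} \<subseteq> E - {e}"
            and *: "f \<noteq> g" "f' \<noteq> g'" "f'' \<noteq> g''"
            "det3 (v e) (v f) (v g) = 0" "det3 (v e) (v f') (v g') = 0" "det3 (v e) (v f'') (v g'') = 0"
            "det3 (v e) (v f) (v f') \<noteq> 0" "det3 (v e) (v f) (v f'') \<noteq> 0" "det3 (v e) (v f') (v f'') \<noteq> 0"
            unfolding three_lines_def by (elim exE conjE) (rule that, assumption+)
          \<comment> \<open>Points on different lines through \<open>e\<close> are different, as
            these lines meet only in \<open>e\<close>.\<close>
          have disj: "g \<noteq> k" if "k \<in> E - {e}" "det3 (v e) (v k) (v h) = 0" "det3 (v e) (v f) (v h) \<noteq> 0"
            "g \<in> E - {e}" "det3 (v e) (v f) (v g) = 0" for f g h k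
          proof
            assume "g = k"
            have "\<not> par (v g) (v e)" using simple that e by auto
            moreover have "det3 (v g) (v h) (v e) = 0" "det3 (v g) (v e) (v f) = 0"
              using that \<open>g = k\<close> by (metis det3_rot)+
            ultimately have "det3 (v h) (v e) (v f) = 0" using det3_trans by blast
            then show False using that by (metis det3_rot)
          qed
          have s: "det3 (v e) (v f') (v f) \<noteq> 0" "det3 (v e) (v f'') (v f) \<noteq> 0" "det3 (v e) (v f'') (v f') \<noteq> 0"
            "det3 (v e) (v g') (v f') = 0" "det3 (v e) (v g'') (v f'') = 0"
            using * by (metis det3_swap23 neg_equal_0_iff_equal)+
          have ne: "f \<noteq> e" "g \<noteq> e" "f' \<noteq> e" "g' \<noteq> e" "f'' \<noteq> e" "g'' \<noteq> e" using E by simp_all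
          have n1: "f \<noteq> f'" "f \<noteq> f''" "f' \<noteq> f''" using *(7-9) by auto
          have n2: "g \<noteq> f'" "g \<noteq> f''" "g' \<noteq> f" "g' \<noteq> f''" "g'' \<noteq> f" "g'' \<noteq> f'"
            using *(4-9) s by auto
          have n3: "g \<noteq> g'" by (rule disj[of g' f' f g]) (use * s E in simp_all)
          have n4: "g \<noteq> g''" by (rule disj[of g'' f'' f g]) (use * s E in simp_all)
          have n5: "g' \<noteq> g''" by (rule disj[of g'' f'' f' g']) (use * s E in simp_all)
          have "distinct [e, f, g, f', g', f'', g'']"
            using ne ne[symmetric] *(1-3) n1 n2 n2[symmetric] n3 n4 n5 by simp
          moreover have "{e, f, g, f', g', f'', g''} \<subseteq> E" using E e by simp
          ultimately show ?thesis using *(4-9) by meson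
        qed
        \<comment> \<open>An element of \<open>L\<close> lies on no line with two others, so it
          cannot have three lines; the bound on \<open>E - L\<close> then holds for \<open>E\<close>
          itself.\<close>
        have "L \<inter> E = {}"
        proof (rule ccontr)
          assume "L \<inter> E \<noteq> {}"
          then obtain l where l: "l \<in> L \<inter> E" by blast
          then obtain f g where "f \<in> E - {l}" "g \<in> E - {l}" "f \<noteq> g" "det3 (v l) (v f) (v g) = 0"
            using lines[of l] by auto
          then show False using coloop[OF l] simple by blast
        qed
        then have c: "card E \<le> 7" using seven by (metis Diff_triv inf_commute)
        have "\<exists>f g f' g' f'' g''. distinct [e, f, g, f', g', f'', g''] \<and>
          E = {e, f, g, f', g', f'', g''} \<and> det3 (v e) (v f) (v g) = 0 \<and>
          det3 (v e) (v f') (v g') = 0 \<and> det3 (v e) (v f'') (v g'') = 0 \<and>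
          det3 (v e) (v f) (v f') \<noteq> 0 \<and> det3 (v e) (v f) (v f'') \<noteq> 0 \<and> det3 (v e) (v f') (v f'') \<noteq> 0"
          if e: "e \<in> E" for e
        proof -
          have "E = {e, f, g, f', g', f'', g''}" if "distinct [e, f, g, f', g', f'', g'']"
            "{e, f, g, f', g', f'', g''} \<subseteq> E" for f g f' g' f'' g''
          proof -
            have "card {e, f, g, f', g', f'', g''} = 7" using that(1) by simp
            then show ?thesis using card_subset_eq[OF fin that(2)] card_mono[OF fin that(2)] c by simp
          qed
          then show ?thesis using lines[OF e] by meson
        qed
        then show False using no_fano_configuration[of E v] simple False by blast
      qed
    qed
  qed
qed

subsection \<open>Linear dependence of families\<close>

definition dep :: "('i \<Rightarrow> 'k \<Rightarrow> complex) \<Rightarrow> 'i set \<Rightarrow> bool" where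
  "dep v S \<longleftrightarrow> (\<exists>c. (\<exists>i\<in>S. c i \<noteq> 0) \<and> (\<forall>k. (\<Sum>i\<in>S. c i * v i k) = 0))"

lemma dep_zero: "finite S \<Longrightarrow> i \<in> S \<Longrightarrow> (\<And>k. v i k = 0) \<Longrightarrow> dep v S"
  unfolding dep_def
  by (rule exI[of _ "\<lambda>j. if j = i then 1 else 0"]) (auto intro!: sum.neutral)

lemma dep_cong: "(\<And>i k. i \<in> S \<Longrightarrow> v i k = w i k) \<Longrightarrow> dep v S \<longleftrightarrow> dep w S"
  unfolding dep_def by simp

lemma dep_mono:
  assumes "dep v S" "S \<subseteq> T" "finite T"
  shows "dep v T"
proof -
  obtain c where c: "\<exists>i\<in>S. c i \<noteq> 0" "\<And>k. (\<Sum>i\<in>S. c i * v i k) = 0"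
    using assms(1) unfolding dep_def by blast
  have "(\<Sum>i\<in>T. (if i \<in> S then c i else 0) * v i k) = (\<Sum>i\<in>S. c i * v i k)" for k
    by (rule sum.mono_neutral_cong_right) (use assms in auto)
  with c show ?thesis unfolding dep_def using assms(2)
    by (intro exI[of _ "\<lambda>i. if i \<in> S then c i else 0"]) auto
qed

text \<open>One step of Gaussian elimination with pivot \<open>v j k0\<close>, cleared of
  denominators so that polynomial entries stay polynomial.\<close>

lemma dep_insert_eliminate:
  assumes "finite S" "j \<notin> S" and nz: "v j k0 \<noteq> 0"
  shows "dep v (insert j S) \<longleftrightarrow> dep (\<lambda>i k. v j k0 * v i k - v i k0 * v j k) S"
proof
  assume "dep v (insert j S)"
  then obtain c where c: "\<exists>i\<in>insert j S. c i \<noteq> 0" "\<And>k. (\<Sum>i\<in>insert j S. c i * v i k) = 0"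
    unfolding dep_def by blast
  have s: "(\<Sum>i\<in>S. c i * v i k) = - c j * v j k" for k
    using c(2)[of k] assms(1,2) by (simp add: add_eq_0_iff)
  have "\<exists>i\<in>S. c i \<noteq> 0"
  proof (rule ccontr)
    assume "\<not> ?thesis"
    then show False using c(1) s[of k0] nz by auto
  qed
  moreover have "(\<Sum>i\<in>S. c i * (v j k0 * v i k - v i k0 * v j k)) = 0" for k
  proof -
    have "(\<Sum>i\<in>S. c i * (v j k0 * v i k - v i k0 * v j k)) =
        v j k0 * (\<Sum>i\<in>S. c i * v i k) - v j k * (\<Sum>i\<in>S. c i * v i k0)"
      by (simp add: sum_distrib_left sum_subtractf algebra_simps)
    then show ?thesis by (simp add: s algebra_simps)
  qed
  ultimately show "dep (\<lambda>i k. v j k0 * v i k - v i k0 * v j k) S" unfolding dep_def by blast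
next
  assume "dep (\<lambda>i k. v j k0 * v i k - v i k0 * v j k) S"
  then obtain c i where c: "i \<in> S" "c i \<noteq> 0" "\<And>k. (\<Sum>i\<in>S. c i * (v j k0 * v i k - v i k0 * v j k)) = 0"
    unfolding dep_def by blast
  define d where "d i = (if i = j then - (\<Sum>i\<in>S. c i * v i k0) else v j k0 * c i)" for i
  have "(\<Sum>i\<in>insert j S. d i * v i k) = 0" for k
  proof -
    have "(\<Sum>i\<in>S. d i * v i k) = (\<Sum>i\<in>S. v j k0 * c i * v i k)"
      using assms(2) by (intro sum.cong) (auto simp: d_def)
    then have "(\<Sum>i\<in>insert j S. d i * v i k) = (\<Sum>i\<in>S. c i * (v j k0 * v i k - v i k0 * v j k))"
      using assms(1,2) by (simp add: d_def sum_distrib_left sum_subtractf algebra_simps)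
    then show ?thesis using c by simp
  qed
  moreover have "d i \<noteq> 0" using c nz assms(2) by (auto simp: d_def)
  ultimately show "dep v (insert j S)" unfolding dep_def using c(1) by blast
qed

text \<open>Elimination replaces the minors of the matrix: a pivot that is nonzero at
  \<open>z0\<close> is a nonzero polynomial and vanishes at finitely many parameters only.\<close>

lemma indep_generic:
  fixes p :: "'i \<Rightarrow> 'k \<Rightarrow> complex poly"
  assumes "finite S" "\<not> dep (\<lambda>i k. poly (p i k) z0) S"
  shows "\<forall>\<^sub>F z in cofinite. \<not> dep (\<lambda>i k. poly (p i k) z) S"
  using assms
proof (induction S arbitrary: p rule: finite_induct)
  case empty
  then show ?case by (simp add: dep_def)
next
  case (insert j S)
  obtain k0 where k0: "poly (p j k0) z0 \<noteq> 0"
    using insert dep_zero[of "insert j S" j "\<lambda>i k. poly (p i k) z0"] by auto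
  define q where "q i k = p j k0 * p i k - p i k0 * p j k" for i k
  have step: "dep (\<lambda>i k. poly (p i k) z) (insert j S) \<longleftrightarrow> dep (\<lambda>i k. poly (q i k) z) S"
    if "poly (p j k0) z \<noteq> 0" for z
    using dep_insert_eliminate[of S j "\<lambda>i k. poly (p i k) z" k0] insert that by (simp add: q_def)
  have "\<forall>\<^sub>F z in cofinite. \<not> dep (\<lambda>i k. poly (q i k) z) S"
    using insert step[OF k0] by blast
  moreover have "\<forall>\<^sub>F z in cofinite. poly (p j k0) z \<noteq> 0"
  proof -
    have "p j k0 \<noteq> 0" using k0 by auto
    then show ?thesis by (simp add: eventually_cofinite poly_roots_finite)
  qed
  ultimately show ?case by eventually_elim (simp add: step)
qed

lemma lin_indep_family_iff:
  assumes "finite S"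
  shows "lin_indep_family \<alpha> S \<longleftrightarrow> \<not> dep (\<lambda>i k. \<alpha> i $ k) S"
proof -
  have eq: "(\<forall>k. (\<Sum>i\<in>S. c i * \<alpha> i $ k) = 0) \<longleftrightarrow> (\<Sum>i\<in>S. c i *s \<alpha> i) = 0" for c
    by (simp add: vec_eq_iff)
  show ?thesis
  proof (cases "inj_on \<alpha> S")
    case True
    have "vec.dependent (\<alpha> ` S) \<longleftrightarrow> dep (\<lambda>i k. \<alpha> i $ k) S"
    proof
      assume "vec.dependent (\<alpha> ` S)"
      then obtain u where u: "\<exists>v\<in>\<alpha> ` S. u v \<noteq> 0" "(\<Sum>v\<in>\<alpha> ` S. u v *s v) = 0"
        using assms by (auto simp: vec.dependent_finite)
      then have "(\<Sum>i\<in>S. u (\<alpha> i) *s \<alpha> i) = 0" by (simp add: sum.reindex[OF True])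
      with u(1) show "dep (\<lambda>i k. \<alpha> i $ k) S" unfolding dep_def eq
        by (intro exI[of _ "u \<circ> \<alpha>"]) auto
    next
      assume "dep (\<lambda>i k. \<alpha> i $ k) S"
      then obtain c where c: "\<exists>i\<in>S. c i \<noteq> 0" "(\<Sum>i\<in>S. c i *s \<alpha> i) = 0" unfolding dep_def eq by blast
      have "(\<Sum>v\<in>\<alpha> ` S. c (the_inv_into S \<alpha> v) *s v) = (\<Sum>i\<in>S. c i *s \<alpha> i)"
        by (simp add: sum.reindex[OF True] the_inv_into_f_f[OF True] cong: sum.cong)
      moreover have "\<exists>v\<in>\<alpha> ` S. c (the_inv_into S \<alpha> v) \<noteq> 0"
        using c(1) by (auto simp: the_inv_into_f_f[OF True])
      ultimately show "vec.dependent (\<alpha> ` S)"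
        using assms c(2) unfolding vec.dependent_finite[OF finite_imageI[OF assms]]
        by (intro exI[of _ "c \<circ> the_inv_into S \<alpha>"]) auto
    qed
    with True show ?thesis by (simp add: lin_indep_family_def)
  next
    case False
    then obtain i j where ij: "i \<in> S" "j \<in> S" "i \<noteq> j" "\<alpha> i = \<alpha> j" by (auto simp: inj_on_def)
    have "dep (\<lambda>i k. \<alpha> i $ k) {i, j}"
      unfolding dep_def using ij by (intro exI[of _ "\<lambda>l. if l = i then 1 else -1"]) auto
    then have "dep (\<lambda>i k. \<alpha> i $ k) S" using dep_mono ij assms by blast
    with False show ?thesis by (simp add: lin_indep_family_def)
  qed
qed

section \<open>Dependence in dimension 3 in terms of \<open>par\<close> and
  \<open>det3\<close>\<close>

lemma dep_card:
  fixes v :: "'i \<Rightarrow> 3 \<Rightarrow> complex"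
  assumes "finite S" "card S > 3"
  shows "dep v S"
proof (rule ccontr)
  assume n: "\<not> dep v S"
  \<comment> \<open>Renumbering is needed because \<open>lin_indep_family\<close> is about families
    indexed by \<open>nat\<close>.\<close>
  obtain f where f: "bij_betw f {0..<card S} S" using ex_bij_betw_nat_finite[OF assms(1)] by blast
  have "\<not> dep (\<lambda>i. v (f i)) {0..<card S}"
  proof
    assume "dep (\<lambda>i. v (f i)) {0..<card S}"
    then obtain c where c: "\<exists>i\<in>{0..<card S}. c i \<noteq> 0" "\<And>k. (\<Sum>i\<in>{0..<card S}. c i * v (f i) k) = 0"
      unfolding dep_def by blast
    define g where "g = the_inv_into {0..<card S} f"
    have g: "g (f i) = i" if "i \<in> {0..<card S}" for i
      using f that by (simp add: g_def bij_betw_def the_inv_into_f_f)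
    have "(\<Sum>i\<in>S. c (g i) * v i k) = (\<Sum>i\<in>{0..<card S}. c i * v (f i) k)" for k
      by (subst sum.reindex_bij_betw[OF f, symmetric]) (simp add: g)
    moreover have "\<exists>i\<in>S. c (g i) \<noteq> 0" using c(1) f g by (metis bij_betwE)
    ultimately have "dep v S" using c(2) unfolding dep_def by (intro exI[of _ "c \<circ> g"]) auto
    with n show False by blast
  qed
  then have "lin_indep_family (\<lambda>i. \<chi> k. v (f i) k) {0..<card S}"
    by (subst lin_indep_family_iff) (auto simp: vec_lambda_inverse)
  then have "inj_on (\<lambda>i. \<chi> k. v (f i) k) {0..<card S}"
    "vec.independent ((\<lambda>i. \<chi> k. v (f i) k) ` {0..<card S})"
    by (auto simp: lin_indep_family_def)
  then have "card S \<le> vec.dim (UNIV :: (complex^3) set)"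
    using vec.independent_card_le_dim[of "(\<lambda>i. \<chi> k. v (f i) k) ` {0..<card S}" UNIV]
    by (auto simp: card_image)
  then show False using assms(2) by (simp add: vec.dim_UNIV card_cart_basis)
qed

lemma dep_1: "dep v {i} \<longleftrightarrow> v i = (\<lambda>_. 0)"
  unfolding dep_def by (auto intro!: exI[of _ "\<lambda>_. 1"])

lemma dep_2:
  fixes v :: "'i \<Rightarrow> 3 \<Rightarrow> complex"
  assumes "i \<noteq> j"
  shows "dep v {i, j} \<longleftrightarrow> par (v i) (v j)"
proof
  assume "dep v {i, j}"
  then obtain c where c: "c i \<noteq> 0 \<or> c j \<noteq> 0" "\<And>k. c i * v i k + c j * v j k = 0"
    unfolding dep_def using assms by auto
  have "c i * (v i k * v j l - v i l * v j k) = 0" "c j * (v i k * v j l - v i l * v j k) = 0" for k l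
    using c(2)[of k] c(2)[of l] by algebra+
  then show "par (v i) (v j)" unfolding par_def using c(1) by (metis mult_eq_0_iff right_minus_eq)
next
  assume par: "par (v i) (v j)"
  show "dep v {i, j}"
  proof (cases "v j = (\<lambda>_. 0)")
    case True
    then show ?thesis using dep_zero[of "{i, j}" j v] by simp
  next
    case False
    then obtain a where "v i = (\<lambda>k. a * v j k)" using par par_nonzero by blast
    then show ?thesis unfolding dep_def using assms
      by (intro exI[of _ "\<lambda>l. if l = i then 1 else - a"]) auto
  qed
qed

lemma det3_eq_0_if_killed:
  fixes a b c \<phi> :: "3 \<Rightarrow> complex"
  assumes "\<exists>x. \<phi> x \<noteq> 0" "(\<Sum>x\<in>UNIV. \<phi> x * a x) = 0" "(\<Sum>x\<in>UNIV. \<phi> x * b x) = 0" "(\<Sum>x\<in>UNIV. \<phi> x * c x) = 0"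
  shows "det3 a b c = 0"
proof -
  have "\<phi> 1 * det3 a b c = 0" "\<phi> 2 * det3 a b c = 0" "\<phi> 3 * det3 a b c = 0"
    using assms(2-4) unfolding sum_3 det3_def by algebra+
  moreover have "\<phi> 1 \<noteq> 0 \<or> \<phi> 2 \<noteq> 0 \<or> \<phi> 3 \<noteq> 0" using assms(1) forall_3[of "\<lambda>x. \<phi> x = 0"] by blast
  ultimately show ?thesis by auto
qed

lemma dep_3:
  fixes v :: "'i \<Rightarrow> 3 \<Rightarrow> complex"
  assumes "distinct [i, j, k]"
  shows "dep v {i, j, k} \<longleftrightarrow> det3 (v i) (v j) (v k) = 0"
proof
  assume "dep v {i, j, k}"
  then obtain c where c: "c i \<noteq> 0 \<or> c j \<noteq> 0 \<or> c k \<noteq> 0"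
    and *: "\<And>x. c i * v i x + c j * v j x + c k * v k x = 0"
    unfolding dep_def using assms by (auto simp: add.assoc)
  have "c i * det3 (v i) (v j) (v k) = 0" "c j * det3 (v i) (v j) (v k) = 0" "c k * det3 (v i) (v j) (v k) = 0"
    using *[of 1] *[of 2] *[of 3] unfolding det3_def by algebra+
  then show "det3 (v i) (v j) (v k) = 0" using c by auto
next
  assume det: "det3 (v i) (v j) (v k) = 0"
  show "dep v {i, j, k}"
  proof (cases "par (v i) (v j)")
    case True
    then have "dep v {i, j}" using dep_2[of i j v] assms by auto
    then show ?thesis by (rule dep_mono) auto
  next
    case False
    moreover have "det3 (v k) (v i) (v j) = 0" using det by (metis det3_rot)
    ultimately obtain s t where "v k = (\<lambda>x. s * v i x + t * v j x)" using det3_span2 by blast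
    then show ?thesis unfolding dep_def using assms
      by (intro exI[of _ "\<lambda>l. if l = i then s else if l = j then t else -1"]) auto
  qed
qed

text \<open>If all determinants vanish, the vectors lie in a plane, and a plane is the kernel of a
  functional. The cases are rank two, one and zero.\<close>

lemma common_kernel:
  fixes u :: "'i \<Rightarrow> 3 \<Rightarrow> complex"
  assumes det: "\<And>a b c. \<lbrakk>a \<in> T; b \<in> T; c \<in> T\<rbrakk> \<Longrightarrow> det3 (u a) (u b) (u c) = 0"
  shows "\<exists>\<phi>. (\<exists>x. \<phi> x \<noteq> 0) \<and> (\<forall>e\<in>T. (\<Sum>x\<in>UNIV. \<phi> x * u e x) = 0)"
proof -
  consider (np) a b where "a \<in> T" "b \<in> T" "\<not> par (u a) (u b)"
    | (par) a x where "a \<in> T" "u a x \<noteq> 0" "\<And>e. e \<in> T \<Longrightarrow> par (u e) (u a)"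
    | (zero) "\<And>e x. e \<in> T \<Longrightarrow> u e x = 0"
    by blast
  then show ?thesis
  proof cases
    case np
    \<comment> \<open>The cross product of \<open>u a\<close> and \<open>u b\<close>.\<close>
    define \<phi> :: "3 \<Rightarrow> complex" where "\<phi> x = (if x = 1 then u a 2 * u b 3 - u a 3 * u b 2
      else if x = 2 then u a 3 * u b 1 - u a 1 * u b 3 else u a 1 * u b 2 - u a 2 * u b 1)" for x
    have "(\<Sum>x\<in>UNIV. \<phi> x * u e x) = det3 (u a) (u b) (u e)" for e
      by (simp add: sum_3 \<phi>_def det3_def algebra_simps)
    moreover have "\<exists>x. \<phi> x \<noteq> 0"
    proof (rule ccontr)
      assume "\<nexists>x. \<phi> x \<noteq> 0"
      then have "\<phi> 1 = 0" "\<phi> 2 = 0" "\<phi> 3 = 0" by auto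
      then have "par (u a) (u b)" by (auto simp: \<phi>_def par_3)
      with np show False by blast
    qed
    ultimately show ?thesis using np det by (intro exI[of _ \<phi>]) auto
  next
    case par
    have "(1 :: 3) \<noteq> 2" by simp
    \<comment> \<open>Any second coordinate will do: the functional uses only \<open>x\<close> and
      \<open>y\<close> and vanishes on the multiples of \<open>u a\<close>.\<close>
    then obtain y where y: "x \<noteq> y" by metis
    define \<phi> :: "3 \<Rightarrow> complex" where "\<phi> = (\<lambda>z. if z = x then u a y else if z = y then - u a x else 0)"
    have "(\<Sum>z\<in>UNIV. \<phi> z * u e z) = u a y * u e x - u a x * u e y" for e
    proof -
      have "(\<Sum>z\<in>UNIV. \<phi> z * u e z) = (\<Sum>z\<in>{x, y}. \<phi> z * u e z)"
        by (rule sum.mono_neutral_right) (auto simp: \<phi>_def)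
      then show ?thesis using y by (simp add: \<phi>_def)
    qed
    moreover have "u a y * u e x - u a x * u e y = 0" if "e \<in> T" for e
      using par(3)[OF that] unfolding par_def by (simp add: mult.commute)
    moreover have "\<phi> y \<noteq> 0" using par(2) y by (simp add: \<phi>_def)
    ultimately show ?thesis by (intro exI[of _ \<phi>]) auto
  next
    case zero
    then show ?thesis by (intro exI[of _ "\<lambda>_. 1"]) simp
  qed
qed

text \<open>More than three vectors are always dependent here, so the degeneracies of at most three
  vectors account for all dependences.\<close>

lemma dep_transfer:
  fixes v u :: "'i \<Rightarrow> 3 \<Rightarrow> complex"
  assumes "finite S" "dep v S"
    and "\<And>i. i \<in> S \<Longrightarrow> v i = (\<lambda>_. 0) \<Longrightarrow> u i = (\<lambda>_. 0)"
    and "\<And>i j. \<lbrakk>i \<in> S; j \<in> S; par (v i) (v j)\<rbrakk> \<Longrightarrow> par (u i) (u j)"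
    and "\<And>i j k. \<lbrakk>i \<in> S; j \<in> S; k \<in> S; det3 (v i) (v j) (v k) = 0\<rbrakk> \<Longrightarrow> det3 (u i) (u j) (u k) = 0"
  shows "dep u S"
proof -
  consider "card S > 3" | "card S = 0" | "card S = 1" | "card S = 2" | "card S = 3" by linarith
  then show ?thesis
  proof cases
    case 1
    then show ?thesis using dep_card assms(1) by blast
  next
    case 2
    then show ?thesis using assms(1,2) by (simp add: dep_def)
  next
    case 3
    then obtain i where "S = {i}" by (auto simp: card_1_singleton_iff)
    then show ?thesis using assms dep_1[of _ i] by auto
  next
    case 4
    then obtain i j where "S = {i, j}" "i \<noteq> j" by (auto simp: card_2_iff)
    then show ?thesis using assms(2) assms(4)[of i j] dep_2[of i j] by auto
  next
    case 5
    then obtain i j k where S: "S = {i, j, k}" "distinct [i, j, k]" by (auto simp: card_3_iff)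
    then show ?thesis using assms(2) assms(5)[of i j k] dep_3[OF S(2)] by auto
  qed
qed

subsection \<open>Low rank, low corank and Gale duality\<close>

text \<open>Finitely many exceptions are allowed because a curve can avoid them; the family made by
  duality is controlled only where a certain determinant is nonzero.\<close>

definition lift :: "('i \<Rightarrow> 'k \<Rightarrow> complex) \<Rightarrow> ('i \<Rightarrow> 'k \<Rightarrow> complex) \<Rightarrow> 'i set \<Rightarrow> ('i \<Rightarrow> 'k \<Rightarrow> complex poly) \<Rightarrow> bool" where
  "lift \<alpha> \<beta> E q \<longleftrightarrow> (\<forall>i\<in>E. \<forall>k. poly (q i k) 0 = \<alpha> i k \<and> poly (q i k) 1 = \<beta> i k) \<and>
     (\<forall>S\<subseteq>E. dep \<alpha> S \<longrightarrow> (\<forall>\<^sub>F z in cofinite. dep (\<lambda>i k. poly (q i k) z) S))"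

lemma lift_generic:
  assumes "finite E" "lift \<alpha> \<beta> E q"
  shows "\<forall>\<^sub>F z in cofinite. \<forall>S\<in>Pow E. dep (\<lambda>i k. poly (q i k) z) S \<longleftrightarrow> dep \<alpha> S"
proof (rule eventually_ball_finite)
  show "\<forall>S\<in>Pow E. \<forall>\<^sub>F z in cofinite. dep (\<lambda>i k. poly (q i k) z) S \<longleftrightarrow> dep \<alpha> S"
  proof
    fix S assume S: "S \<in> Pow E"
    show "\<forall>\<^sub>F z in cofinite. dep (\<lambda>i k. poly (q i k) z) S \<longleftrightarrow> dep \<alpha> S"
    proof (cases "dep \<alpha> S")
      case True
      then have "\<forall>\<^sub>F z in cofinite. dep (\<lambda>i k. poly (q i k) z) S" using assms S unfolding lift_def by auto
      then show ?thesis by eventually_elim (simp add: True)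
    next
      case False
      have "dep (\<lambda>i k. poly (q i k) 0) S \<longleftrightarrow> dep \<alpha> S"
        by (rule dep_cong) (use assms S in \<open>auto simp: lift_def\<close>)
      moreover have "finite S" using assms(1) S finite_subset by auto
      ultimately have "\<forall>\<^sub>F z in cofinite. \<not> dep (\<lambda>i k. poly (q i k) z) S" using False indep_generic by blast
      then show ?thesis by eventually_elim (simp add: False)
    qed
  qed
qed (use assms in simp)

text \<open>Coordinates off \<open>I\<close> are 0, so that an index map \<open>h\<close> whose
  range is larger than \<open>I\<close> merely adds zero coordinates.\<close>

definition coords :: "('i \<Rightarrow> 'k \<Rightarrow> complex) \<Rightarrow> 'i set \<Rightarrow> 'i set \<Rightarrow> ('i \<Rightarrow> 'i \<Rightarrow> complex) \<Rightarrow> bool" where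
  "coords \<alpha> I E X \<longleftrightarrow> (\<forall>e\<in>E. \<forall>k. \<alpha> e k = (\<Sum>i\<in>I. X e i * \<alpha> i k)) \<and> (\<forall>e i. i \<notin> I \<longrightarrow> X e i = 0)"

lemma indep_coeffs_zero:
  "\<not> dep \<alpha> I \<Longrightarrow> (\<And>k. (\<Sum>i\<in>I. c i * \<alpha> i k) = 0) \<Longrightarrow> i \<in> I \<Longrightarrow> c i = 0"
  unfolding dep_def by blast

lemma sum_coords:
  assumes "coords \<alpha> I E X" "S \<subseteq> E"
  shows "(\<Sum>e\<in>S. c e * \<alpha> e k) = (\<Sum>i\<in>I. (\<Sum>e\<in>S. c e * X e i) * \<alpha> i k)"
proof -
  have "(\<Sum>e\<in>S. c e * \<alpha> e k) = (\<Sum>e\<in>S. \<Sum>i\<in>I. c e * X e i * \<alpha> i k)"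
  proof (rule sum.cong)
    fix e assume "e \<in> S"
    then have "\<alpha> e k = (\<Sum>i\<in>I. X e i * \<alpha> i k)" using assms unfolding coords_def by blast
    then show "c e * \<alpha> e k = (\<Sum>i\<in>I. c e * X e i * \<alpha> i k)" by (simp add: sum_distrib_left mult.assoc)
  qed simp
  also have "\<dots> = (\<Sum>i\<in>I. \<Sum>e\<in>S. c e * X e i * \<alpha> i k)" by (rule sum.swap)
  finally show ?thesis by (simp add: sum_distrib_right)
qed

text \<open>Since \<open>I\<close> is independent, a combination vanishes only if its coordinates
  do, so both families have the same relations.\<close>

lemma dep_coords:
  assumes "\<not> dep \<alpha> I" "coords \<alpha> I E X" "S \<subseteq> E" "I \<subseteq> range h"
  shows "dep \<alpha> S \<longleftrightarrow> dep (\<lambda>e x. X e (h x)) S"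
proof -
  have "(\<forall>k. (\<Sum>e\<in>S. c e * \<alpha> e k) = 0) \<longleftrightarrow> (\<forall>x. (\<Sum>e\<in>S. c e * X e (h x)) = 0)" for c
  proof
    assume a: "\<forall>k. (\<Sum>e\<in>S. c e * \<alpha> e k) = 0"
    then have "(\<Sum>e\<in>S. c e * X e i) = 0" if "i \<in> I" for i
      using indep_coeffs_zero[OF assms(1), of "\<lambda>i. \<Sum>e\<in>S. c e * X e i"] that
      unfolding sum_coords[OF assms(2,3)] by blast
    moreover have "(\<Sum>e\<in>S. c e * X e i) = 0" if "i \<notin> I" for i
      using assms(2) that unfolding coords_def by simp
    ultimately show "\<forall>x. (\<Sum>e\<in>S. c e * X e (h x)) = 0" by blast
  next
    assume a: "\<forall>x. (\<Sum>e\<in>S. c e * X e (h x)) = 0"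
    then have "(\<Sum>e\<in>S. c e * X e i) = 0" if "i \<in> I" for i
      using that assms(4) by blast
    then show "\<forall>k. (\<Sum>e\<in>S. c e * \<alpha> e k) = 0"
      unfolding sum_coords[OF assms(2,3)] by simp
  qed
  then show ?thesis unfolding dep_def by simp
qed

lemma same3_if_same_dep:
  fixes v w :: "'i \<Rightarrow> 3 \<Rightarrow> complex"
  assumes same: "\<And>S. S \<subseteq> E \<Longrightarrow> dep v S \<longleftrightarrow> dep w S"
  shows "same3 v w E"
  unfolding same3_def
proof (intro conjI ballI)
  fix i assume "i \<in> E"
  then show "v i = (\<lambda>_. 0) \<longleftrightarrow> w i = (\<lambda>_. 0)" using same[of "{i}"] by (simp add: dep_1)
next
  fix i j assume "i \<in> E" "j \<in> E"
  then show "par (v i) (v j) \<longleftrightarrow> par (w i) (w j)"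
    using same[of "{i, j}"] dep_2[of i j] by (cases "i = j") (auto simp: par_def)
next
  fix i j k assume "i \<in> E" "j \<in> E" "k \<in> E"
  then show "det3 (v i) (v j) (v k) = 0 \<longleftrightarrow> det3 (w i) (w j) (w k) = 0"
    using same[of "{i, j, k}"] dep_3[of i j k] by (cases "distinct [i, j, k]") auto
qed

lemma sum_range:
  fixes f :: "'i \<Rightarrow> 'a::comm_monoid_add" and h :: "3 \<Rightarrow> 'i"
  assumes "inj h" "I \<subseteq> range h" "\<And>i. i \<notin> I \<Longrightarrow> f i = 0"
  shows "(\<Sum>x\<in>UNIV. f (h x)) = (\<Sum>i\<in>I. f i)"
proof -
  have "(\<Sum>x\<in>UNIV. f (h x)) = (\<Sum>i\<in>range h. f i)" by (simp add: sum.reindex[OF assms(1)])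
  also have "\<dots> = (\<Sum>i\<in>I. f i)" by (rule sum.mono_neutral_right) (use assms in auto)
  finally show ?thesis .
qed

text \<open>Coordinates with respect to the common basis \<open>I\<close> are vectors in dimension
  3, where \<open>lift3_exists\<close> applies; a moving basis transports the result back.\<close>

lemma lift_low_rank:
  fixes \<alpha> \<beta> :: "'i \<Rightarrow> 'k \<Rightarrow> complex" and h :: "3 \<Rightarrow> 'i"
  assumes "finite E" "card E \<le> 7"
    and same: "\<And>S. S \<subseteq> E \<Longrightarrow> dep \<alpha> S \<longleftrightarrow> dep \<beta> S"
    and h: "inj h" "I \<subseteq> range h"
    and \<alpha>: "\<not> dep \<alpha> I" "coords \<alpha> I E X" and \<beta>: "\<not> dep \<beta> I" "coords \<beta> I E Y"
  shows "\<exists>q. lift \<alpha> \<beta> E q"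
proof -
  define v where "v e x = X e (h x)" for e x
  define w where "w e x = Y e (h x)" for e x
  have v: "dep \<alpha> S \<longleftrightarrow> dep v S" if "S \<subseteq> E" for S
    unfolding v_def using dep_coords[OF \<alpha> that h(2)] .
  have w: "dep \<beta> S \<longleftrightarrow> dep w S" if "S \<subseteq> E" for S
    unfolding w_def using dep_coords[OF \<beta> that h(2)] .
  have "same3 v w E" using same v w by (intro same3_if_same_dep) blast
  then obtain p where p: "lift3 v w E p"
    using lift3_exists[of E "{}" v w] assms(1,2) by auto
  \<comment> \<open>The basis vectors move on segments, the coordinates by \<open>p\<close>. At both
    ends names outside \<open>I\<close> have coordinate 0. In between a degenerate basis does no
    harm, as a linear map preserves relations.\<close>
  define q where "q e k = (\<Sum>x\<in>UNIV. p e x * lin (\<alpha> (h x) k) (\<beta> (h x) k))" for e k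
  have ends: "poly (q e k) 0 = \<alpha> e k" "poly (q e k) 1 = \<beta> e k" if e: "e \<in> E" for e k
  proof -
    have "poly (q e k) 0 = (\<Sum>x\<in>UNIV. X e (h x) * \<alpha> (h x) k)"
      using p e unfolding lift3_def q_def v_def by (simp add: poly_sum)
    also have "\<dots> = \<alpha> e k"
      using \<alpha>(2) e sum_range[OF h, of "\<lambda>i. X e i * \<alpha> i k"] by (simp add: coords_def)
    finally show "poly (q e k) 0 = \<alpha> e k" .
    have "poly (q e k) 1 = (\<Sum>x\<in>UNIV. Y e (h x) * \<beta> (h x) k)"
      using p e unfolding lift3_def q_def w_def by (simp add: poly_sum)
    also have "\<dots> = \<beta> e k"
      using \<beta>(2) e sum_range[OF h, of "\<lambda>i. Y e i * \<beta> i k"] by (simp add: coords_def)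
    finally show "poly (q e k) 1 = \<beta> e k" .
  qed
  have "dep (\<lambda>e k. poly (q e k) z) S" if S: "S \<subseteq> E" "dep \<alpha> S" for S z
  proof -
    have "dep (\<lambda>e k. poly (p e k) z) S"
    proof (rule dep_transfer)
      show "finite S" using S assms(1) finite_subset by blast
      show "dep v S" using S v by blast
      show "(\<lambda>k. poly (p i k) z) = (\<lambda>_. 0)" if "i \<in> S" "v i = (\<lambda>_. 0)" for i
      proof -
        have "p i = (\<lambda>_. 0)" using p that S unfolding lift3_def by blast
        then show ?thesis by simp
      qed
      show "par (\<lambda>k. poly (p i k) z) (\<lambda>k. poly (p j k) z)" if "i \<in> S" "j \<in> S" "par (v i) (v j)" for i j
        using p that S unfolding lift3_def by (intro poly_par) blast
      show "det3 (\<lambda>k. poly (p i k) z) (\<lambda>k. poly (p j k) z) (\<lambda>l. poly (p k l) z) = 0"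
        if "i \<in> S" "j \<in> S" "k \<in> S" "det3 (v i) (v j) (v k) = 0" for i j k
      proof -
        have "det3 (p i) (p j) (p k) = 0" using p that S unfolding lift3_def by blast
        then show ?thesis by (metis poly_det3 poly_0)
      qed
    qed
    then obtain c where c: "\<exists>e\<in>S. c e \<noteq> 0" "\<And>x. (\<Sum>e\<in>S. c e * poly (p e x) z) = 0"
      unfolding dep_def by blast
    have "(\<Sum>e\<in>S. c e * poly (q e k) z) = 0" for k
    proof -
      have "(\<Sum>e\<in>S. c e * poly (q e k) z) =
          (\<Sum>e\<in>S. \<Sum>x\<in>UNIV. c e * poly (p e x) z * poly (lin (\<alpha> (h x) k) (\<beta> (h x) k)) z)"
        by (simp add: q_def poly_sum sum_distrib_left mult.assoc)
      also have "\<dots> = (\<Sum>x\<in>UNIV. (\<Sum>e\<in>S. c e * poly (p e x) z) * poly (lin (\<alpha> (h x) k) (\<beta> (h x) k)) z)"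
        by (subst sum.swap) (simp add: sum_distrib_right)
      finally show ?thesis by (simp add: c(2))
    qed
    with c(1) show ?thesis unfolding dep_def by blast
  qed
  then have "lift \<alpha> \<beta> E q" using ends unfolding lift_def by simp
  then show ?thesis by blast
qed

text \<open>
  The matrix with columns \<open>gale X I h e\<close> has the space of linear relations among the vectors
  \<open>\<alpha> e\<close> as its row space; it is the Gale dual of \<open>\<alpha>\<close>.
\<close>

definition gale :: "('i \<Rightarrow> 'i \<Rightarrow> complex) \<Rightarrow> 'i set \<Rightarrow> (3 \<Rightarrow> 'i) \<Rightarrow> 'i \<Rightarrow> 3 \<Rightarrow> complex" where
  "gale X I h e x = (if e \<in> I then - X (h x) e else if h x = e then 1 else 0)"

lemma sum_split_basis:
  fixes f :: "'i \<Rightarrow> 'a::comm_monoid_add" and h :: "3 \<Rightarrow> 'i"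
  assumes "finite I" "inj h" "I \<inter> range h = {}"
  shows "(\<Sum>e\<in>I \<union> range h. f e) = (\<Sum>i\<in>I. f i) + (\<Sum>x\<in>UNIV. f (h x))"
  using assms by (simp add: sum.union_disjoint sum.reindex)

lemma sum_gale_relation:
  fixes h :: "3 \<Rightarrow> 'i"
  assumes h: "finite I" "inj h" "I \<inter> range h = {}" and X: "coords \<alpha> I (range h) X"
  shows "(\<Sum>e\<in>I \<union> range h. c e * \<alpha> e k) = (\<Sum>i\<in>I. (c i + (\<Sum>x\<in>UNIV. c (h x) * X (h x) i)) * \<alpha> i k)"
proof -
  have "(\<Sum>x\<in>UNIV. c (h x) * \<alpha> (h x) k) = (\<Sum>e\<in>range h. c e * \<alpha> e k)"
    by (simp add: sum.reindex[OF h(2)])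
  also have "\<dots> = (\<Sum>i\<in>I. (\<Sum>x\<in>UNIV. c (h x) * X (h x) i) * \<alpha> i k)"
    by (subst sum_coords[OF X subset_refl]) (simp add: sum.reindex[OF h(2)])
  finally show ?thesis
    unfolding sum_split_basis[OF h] by (simp add: sum.distrib distrib_right)
qed

text \<open>A relation among the \<open>\<alpha> e\<close> is a functional evaluated at the Gale
  vectors, and its support avoids \<open>T\<close> if the functional kills the Gale vectors of
  \<open>T\<close>.\<close>

lemma dep_iff_gale:
  fixes h :: "3 \<Rightarrow> 'i"
  assumes h: "finite I" "inj h" "I \<inter> range h = {}" and \<alpha>: "\<not> dep \<alpha> I" "coords \<alpha> I (range h) X"
    and T: "T \<subseteq> I \<union> range h"
  shows "dep \<alpha> (I \<union> range h - T) \<longleftrightarrow>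
    (\<exists>\<phi>. (\<exists>x. \<phi> x \<noteq> 0) \<and> (\<forall>e\<in>T. (\<Sum>x\<in>UNIV. \<phi> x * gale X I h e x) = 0))"
    (is "dep \<alpha> (?E - T) \<longleftrightarrow> _")
proof
  \<comment> \<open>The Gale vectors of \<open>range h\<close> are the unit vectors, so the
    functional consists of the values of the relation on \<open>range h\<close>.\<close>
  have gh: "(\<Sum>x\<in>UNIV. \<phi> x * gale X I h (h y) x) = \<phi> y" for \<phi> y
  proof -
    have "\<phi> x * gale X I h (h y) x = (if x = y then \<phi> y else 0)" for x
      using h by (auto simp: gale_def inj_def)
    then show ?thesis by simp
  qed
  have fin: "finite ?E" using h(1) by simp
  {
    assume "dep \<alpha> (?E - T)"
    then obtain c0 where c0: "\<exists>e\<in>?E - T. c0 e \<noteq> 0" "\<And>k. (\<Sum>e\<in>?E - T. c0 e * \<alpha> e k) = 0"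
      unfolding dep_def by blast
    define c where "c e = (if e \<in> T then 0 else c0 e)" for e
    have "(\<Sum>e\<in>?E. c e * \<alpha> e k) = 0" for k
    proof -
      have "(\<Sum>e\<in>?E. c e * \<alpha> e k) = (\<Sum>e\<in>?E - T. c0 e * \<alpha> e k)"
        by (rule sum.mono_neutral_cong_right) (use fin in \<open>auto simp: c_def\<close>)
      then show ?thesis using c0 by simp
    qed
    then have ci: "c i + (\<Sum>x\<in>UNIV. c (h x) * X (h x) i) = 0" if "i \<in> I" for i
      using indep_coeffs_zero[OF \<alpha>(1), of "\<lambda>i. c i + (\<Sum>x\<in>UNIV. c (h x) * X (h x) i)"] that
      unfolding sum_gale_relation[OF h \<alpha>(2)] by blast
    have "(\<Sum>x\<in>UNIV. c (h x) * gale X I h e x) = c e" if e: "e \<in> ?E" for e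
    proof (cases "e \<in> I")
      case True
      then show ?thesis using ci[OF True] by (simp add: gale_def sum_negf add_eq_0_iff)
    next
      case False
      then obtain y where "e = h y" using e by blast
      then show ?thesis using gh[of "\<lambda>x. c (h x)" y] by simp
    qed
    note val = this
    have "\<exists>x. c (h x) \<noteq> 0"
    proof (rule ccontr)
      assume "\<nexists>x. c (h x) \<noteq> 0"
      then have "c e = 0" if "e \<in> ?E" for e using val[OF that] by simp
      then show False using c0(1) unfolding c_def by (metis DiffE)
    qed
    moreover have "\<forall>e\<in>T. (\<Sum>x\<in>UNIV. c (h x) * gale X I h e x) = 0"
    proof
      fix e assume "e \<in> T"
      then have "(\<Sum>x\<in>UNIV. c (h x) * gale X I h e x) = c e" using val T by blast
      then show "(\<Sum>x\<in>UNIV. c (h x) * gale X I h e x) = 0" using \<open>e \<in> T\<close> by (simp add: c_def)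
    qed
    ultimately show "\<exists>\<phi>. (\<exists>x. \<phi> x \<noteq> 0) \<and> (\<forall>e\<in>T. (\<Sum>x\<in>UNIV. \<phi> x * gale X I h e x) = 0)"
      by (intro exI[of _ "\<lambda>x. c (h x)"] conjI)
  }
  assume "\<exists>\<phi>. (\<exists>x. \<phi> x \<noteq> 0) \<and> (\<forall>e\<in>T. (\<Sum>x\<in>UNIV. \<phi> x * gale X I h e x) = 0)"
  then obtain \<phi> y where \<phi>: "\<phi> y \<noteq> 0" "\<And>e. e \<in> T \<Longrightarrow> (\<Sum>x\<in>UNIV. \<phi> x * gale X I h e x) = 0" by blast
  define c where "c e = (\<Sum>x\<in>UNIV. \<phi> x * gale X I h e x)" for e
  have ch: "c (h x) = \<phi> x" for x unfolding c_def by (rule gh)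
  have "c i + (\<Sum>x\<in>UNIV. c (h x) * X (h x) i) = 0" if "i \<in> I" for i
    unfolding ch using that by (simp add: c_def gale_def sum_negf)
  then have "(\<Sum>e\<in>?E. c e * \<alpha> e k) = 0" for k
    unfolding sum_gale_relation[OF h \<alpha>(2)] by simp
  moreover have "(\<Sum>e\<in>?E. c e * \<alpha> e k) = (\<Sum>e\<in>?E - T. c e * \<alpha> e k)" for k
    by (rule sum.mono_neutral_right) (use fin \<phi>(2) in \<open>auto simp: c_def\<close>)
  ultimately have "(\<Sum>e\<in>?E - T. c e * \<alpha> e k) = 0" for k by simp
  moreover have "h y \<in> ?E - T" using \<phi> ch[of y] by (auto simp: c_def)
  ultimately show "dep \<alpha> (?E - T)" unfolding dep_def using ch[of y] \<phi>(1) by metis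
qed

text \<open>This is matroid duality for bases. With repeated entries both sides hold, the complement
  then being larger than the basis \<open>I\<close>.\<close>

lemma det3_gale_iff:
  fixes h :: "3 \<Rightarrow> 'i"
  assumes h: "finite I" "inj h" "I \<inter> range h = {}" and \<alpha>: "\<not> dep \<alpha> I" "coords \<alpha> I (range h) X"
    and abc: "a \<in> I \<union> range h" "b \<in> I \<union> range h" "c \<in> I \<union> range h"
  shows "det3 (gale X I h a) (gale X I h b) (gale X I h c) = 0 \<longleftrightarrow> dep \<alpha> (I \<union> range h - {a, b, c})"
proof -
  have T: "{a, b, c} \<subseteq> I \<union> range h" using abc by blast
  show ?thesis
  proof
    assume "det3 (gale X I h a) (gale X I h b) (gale X I h c) = 0"
    then have "det3 (gale X I h r) (gale X I h s) (gale X I h t) = 0"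
      if "r \<in> {a, b, c}" "s \<in> {a, b, c}" "t \<in> {a, b, c}" for r s t
      using that det3_rot[of "gale X I h a" "gale X I h b" "gale X I h c"]
        det3_rot[of "gale X I h b" "gale X I h c" "gale X I h a"]
        det3_swap12[of "gale X I h a" "gale X I h b" "gale X I h c"]
        det3_swap12[of "gale X I h b" "gale X I h c" "gale X I h a"]
        det3_swap12[of "gale X I h c" "gale X I h a" "gale X I h b"]
      by auto
    then show "dep \<alpha> (I \<union> range h - {a, b, c})"
      unfolding dep_iff_gale[OF h \<alpha> T] by (rule common_kernel)
  next
    assume "dep \<alpha> (I \<union> range h - {a, b, c})"
    then show "det3 (gale X I h a) (gale X I h b) (gale X I h c) = 0"
      unfolding dep_iff_gale[OF h \<alpha> T] by (auto intro: det3_eq_0_if_killed)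
  qed
qed

lemma cramer3:
  fixes a b c d :: "3 \<Rightarrow> 'a::comm_ring_1"
  shows "det3 a b c * d y = det3 d b c * a y + det3 a d c * b y + det3 a b d * c y"
  unfolding det3_def by (insert exhaust_3[of y], elim disjE) (simp_all add: algebra_simps)

text \<open>
  The set \<open>L\<close> consists of zero vectors that pad the configuration to corank 3.  They become
  coloops of the Gale dual and therefore do not count in the bound 7.
\<close>

lemma lift_low_corank:
  fixes \<alpha> \<beta> :: "'i \<Rightarrow> 'k \<Rightarrow> complex" and h :: "3 \<Rightarrow> 'i"
  assumes h: "finite I" "inj h" "I \<inter> range h = {}"
    and L: "card (I \<union> range h - L) \<le> 7" "L \<subseteq> range h" "\<And>l k. l \<in> L \<Longrightarrow> \<alpha> l k = 0"
    and same: "\<And>S. S \<subseteq> I \<union> range h \<Longrightarrow> dep \<alpha> S \<longleftrightarrow> dep \<beta> S"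
    and \<alpha>: "\<not> dep \<alpha> I" "coords \<alpha> I (range h) X" and \<beta>: "\<not> dep \<beta> I" "coords \<beta> I (range h) Y"
  shows "\<exists>q. lift \<alpha> \<beta> (I \<union> range h) q"
proof -
  let ?E = "I \<union> range h"
  define v where "v = gale X I h"
  define w where "w = gale Y I h"
  have fin: "finite ?E" using h by simp
  have vh: "v (h x) = (\<lambda>y. if y = x then 1 else 0)" "w (h x) = (\<lambda>y. if y = x then 1 else 0)" for x
    using h by (auto simp: v_def w_def gale_def inj_def fun_eq_iff)
  have hE: "h x \<in> ?E" for x by simp
  have det: "det3 (v a) (v b) (v c) = 0 \<longleftrightarrow> det3 (w a) (w b) (w c) = 0"
    if "a \<in> ?E" "b \<in> ?E" "c \<in> ?E" for a b c
    unfolding v_def w_def det3_gale_iff[OF h \<alpha> that] det3_gale_iff[OF h \<beta> that]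
    by (rule same) simp
  \<comment> \<open>The unit vectors occur among the Gale vectors by \<open>vh\<close>, so parallel
    and zero vectors are detected by determinants of triples, and \<open>det\<close> is all that has
    to be compared.\<close>
  have par_det: "par a b \<longleftrightarrow> (\<forall>x. det3 a b (\<lambda>y. if y = x then 1 else 0) = 0)" for a b :: "3 \<Rightarrow> complex"
    unfolding forall_3 by (auto simp: det3_def par_3)
  have zero_det: "a = (\<lambda>_. 0) \<longleftrightarrow> (\<forall>x z. det3 a (\<lambda>y. if y = x then 1 else 0) (\<lambda>y. if y = z then 1 else 0) = 0)"
    for a :: "3 \<Rightarrow> complex"
  proof
    assume *: "\<forall>x z. det3 a (\<lambda>y. if y = x then 1 else 0) (\<lambda>y. if y = z then 1 else 0) = 0"
    show "a = (\<lambda>_. 0)"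
      unfolding fun_eq_iff forall_3
      using *[rule_format, of 2 3] *[rule_format, of 3 1] *[rule_format, of 1 2] by (simp add: det3_def)
  qed simp
  have "same3 v w ?E"
    unfolding same3_def
  proof (intro conjI ballI)
    fix i assume "i \<in> ?E"
    then have "\<forall>x z. det3 (v i) (v (h x)) (v (h z)) = 0 \<longleftrightarrow> det3 (w i) (w (h x)) (w (h z)) = 0"
      using det hE by blast
    then show "v i = (\<lambda>_. 0) \<longleftrightarrow> w i = (\<lambda>_. 0)" unfolding zero_det vh by blast
  next
    fix i j assume "i \<in> ?E" "j \<in> ?E"
    then have "\<forall>x. det3 (v i) (v j) (v (h x)) = 0 \<longleftrightarrow> det3 (w i) (w j) (w (h x)) = 0"
      using det hE by blast
    then show "par (v i) (v j) \<longleftrightarrow> par (w i) (w j)" unfolding par_det vh by blast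
  qed (use det in blast)
  moreover have "par (v f) (v g)"
    if l: "l \<in> L \<inter> ?E" "f \<in> ?E - {l}" "g \<in> ?E - {l}" "det3 (v l) (v f) (v g) = 0" for l f g
  proof -
    obtain x where x: "l = h x" using l(1) L(2) by blast
    \<comment> \<open>A zero vector has zero coordinates. Hence coordinate \<open>x\<close> vanishes
      on all other Gale vectors, and the determinant reduces to a minor of \<open>v f\<close> and
      \<open>v g\<close>.\<close>
    have "X (h x) i = 0" for i
    proof (cases "i \<in> I")
      case True
      have "(\<Sum>i\<in>I. X (h x) i * \<alpha> i k) = 0" for k
        using \<alpha>(2) L(3)[of "h x" k] l(1) x unfolding coords_def by auto
      then show ?thesis using indep_coeffs_zero[OF \<alpha>(1)] True by blast
    qed (use \<alpha>(2) in \<open>simp add: coords_def\<close>)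
    then have "v e x = 0" if "e \<in> ?E - {h x}" for e
      using that by (auto simp: v_def gale_def)
    then have "v f x = 0" "v g x = 0" using l x by auto
    then show ?thesis
      using l(4) exhaust_3[of x] unfolding x vh par_3 det3_def by auto
  qed
  ultimately obtain p where p: "lift3 v w ?E p"
    using lift3_exists[OF fin, of L v w] L(1) by blast
  define D where "D = det3 (p (h 1)) (p (h 2)) (p (h 3))"
  \<comment> \<open>By Cramer's rule \<open>- Z i x / D\<close> are the coordinates of
    \<open>p i\<close> in the basis formed by the \<open>p (h x)\<close>. This brings the lifted
    dual into the form of \<open>gale\<close>; clearing the denominator puts the factor
    \<open>D\<close> into \<open>q\<close>.\<close>
  define Z :: "'i \<Rightarrow> 3 \<Rightarrow> complex poly" where "Z i x = - (if x = 1 then det3 (p i) (p (h 2)) (p (h 3))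
    else if x = 2 then det3 (p (h 1)) (p i) (p (h 3)) else det3 (p (h 1)) (p (h 2)) (p i))" for i x
  define b where "b i k = lin (\<alpha> i k) (\<beta> i k)" for i k
  define q where "q e k = (if e \<in> I then D * b e k else \<Sum>i\<in>I. Z i (the_inv h e) * b i k)" for e k
  have p0: "poly (p e y) 0 = v e y" "poly (p e y) 1 = w e y" if "e \<in> ?E" for e y
    using p that unfolding lift3_def by blast+
  have cramer: "D * p i y + (\<Sum>x\<in>UNIV. Z i x * p (h x) y) = 0" for i y
    using cramer3[of "p (h 1)" "p (h 2)" "p (h 3)" "p i" y] by (simp add: D_def Z_def sum_3)
  have qh: "q (h x) k = (\<Sum>i\<in>I. Z i x * b i k)" for x k
    using h by (auto simp: q_def the_inv_f_f)
  \<comment> \<open>At both ends the basis consists of the unit vectors, so nothing is rescaled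
    there.\<close>
  have D0: "poly D 0 = 1" "poly D 1 = 1"
    unfolding D_def poly_det3 p0[OF hE] vh by (simp_all add: det3_def)
  have Z0: "poly (Z i x) 0 = - v i x" "poly (Z i x) 1 = - w i x" if "i \<in> I" for i x
    unfolding Z_def using that exhaust_3[of x] p0[OF hE] p0[of i]
    by (auto simp: poly_det3 vh) (auto simp: det3_def)
  have ends: "poly (q e k) 0 = \<alpha> e k \<and> poly (q e k) 1 = \<beta> e k" if e: "e \<in> ?E" for e k
  proof (cases "e \<in> I")
    case True
    then show ?thesis by (simp add: q_def D0 b_def)
  next
    case False
    then obtain x where x: "e = h x" using e by blast
    have "poly (q e k) 0 = (\<Sum>i\<in>I. X (h x) i * \<alpha> i k)" "poly (q e k) 1 = (\<Sum>i\<in>I. Y (h x) i * \<beta> i k)"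
      unfolding x qh by (auto simp: poly_sum Z0 b_def v_def w_def gale_def intro!: sum.cong)
    then show ?thesis using \<alpha>(2) \<beta>(2) unfolding x coords_def by simp
  qed
  \<comment> \<open>This makes \<open>q\<close> Gale dual to \<open>p\<close> wherever \<open>D\<close> does not vanish.\<close>
  have relation: "(\<Sum>e\<in>?E. p e y * q e k) = 0" for y k
  proof -
    have "(\<Sum>e\<in>?E. p e y * q e k) =
        (\<Sum>i\<in>I. p i y * (D * b i k)) + (\<Sum>x\<in>UNIV. \<Sum>i\<in>I. p (h x) y * (Z i x * b i k))"
      unfolding sum_split_basis[OF h] qh by (simp add: q_def sum_distrib_left)
    also have "\<dots> = (\<Sum>i\<in>I. p i y * (D * b i k) + (\<Sum>x\<in>UNIV. p (h x) y * (Z i x * b i k)))"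
      by (subst sum.swap) (simp add: sum.distrib)
    also have "\<dots> = (\<Sum>i\<in>I. (D * p i y + (\<Sum>x\<in>UNIV. Z i x * p (h x) y)) * b i k)"
      by (simp add: distrib_right sum_distrib_right mult.left_commute mult.assoc)
    finally show ?thesis by (simp add: cramer)
  qed
  have "dep (\<lambda>e k. poly (q e k) z) S" if S: "S \<subseteq> ?E" "dep \<alpha> S" and z: "poly D z \<noteq> 0" for S z
  proof -
    define T where "T = ?E - S"
    have T: "T \<subseteq> ?E" "?E - T = S" using S by (auto simp: T_def)
    \<comment> \<open>A functional killing \<open>v\<close> on the complement \<open>T\<close> makes
      all determinants there vanish, and \<open>p\<close> inherits this. So some functional kills
      \<open>p\<close> on \<open>T\<close> at \<open>z\<close>, and its values are a relation among
      the \<open>q e\<close> supported on \<open>S\<close>.\<close>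
    obtain \<psi> where \<psi>: "\<exists>x. \<psi> x \<noteq> 0" "\<And>e. e \<in> T \<Longrightarrow> (\<Sum>x\<in>UNIV. \<psi> x * v e x) = 0"
      using dep_iff_gale[OF h \<alpha> T(1)] S(2) unfolding T(2) v_def by blast
    have "det3 (\<lambda>k. poly (p i k) z) (\<lambda>k. poly (p j k) z) (\<lambda>l. poly (p k l) z) = 0"
      if "i \<in> T" "j \<in> T" "k \<in> T" for i j k
    proof -
      have "det3 (v i) (v j) (v k) = 0" using det3_eq_0_if_killed[OF \<psi>(1)] \<psi>(2) that by blast
      moreover have "i \<in> ?E" "j \<in> ?E" "k \<in> ?E" using that T(1) by auto
      ultimately have "det3 (p i) (p j) (p k) = 0" using p unfolding lift3_def by blast
      then show ?thesis by (metis poly_det3 poly_0)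
    qed
    then obtain \<phi> where \<phi>: "\<exists>x. \<phi> x \<noteq> 0" "\<And>e. e \<in> T \<Longrightarrow> (\<Sum>x\<in>UNIV. \<phi> x * poly (p e x) z) = 0"
      using common_kernel[of T "\<lambda>e x. poly (p e x) z"] by blast
    define c where "c e = (\<Sum>x\<in>UNIV. \<phi> x * poly (p e x) z)" for e
    \<comment> \<open>Where \<open>D\<close> is nonzero the three basis vectors cannot all be
      killed, so the relation is nontrivial.\<close>
    have "\<exists>x. c (h x) \<noteq> 0"
    proof (rule ccontr)
      assume "\<nexists>x. c (h x) \<noteq> 0"
      then have "poly D z = 0"
        unfolding D_def poly_det3 by (intro det3_eq_0_if_killed[OF \<phi>(1)]) (simp_all add: c_def)
      with z show False by blast
    qed
    then obtain x where x: "c (h x) \<noteq> 0" by blast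
    then have "h x \<in> S" using \<phi>(2) unfolding T_def c_def by blast
    moreover have "(\<Sum>e\<in>S. c e * poly (q e k) z) = 0" for k
    proof -
      have "(\<Sum>e\<in>S. c e * poly (q e k) z) = (\<Sum>e\<in>?E. c e * poly (q e k) z)"
        by (rule sum.mono_neutral_left) (use fin S \<phi>(2) in \<open>auto simp: c_def T_def\<close>)
      also have "\<dots> = (\<Sum>e\<in>?E. \<Sum>x\<in>UNIV. \<phi> x * (poly (p e x) z * poly (q e k) z))"
        by (simp add: c_def sum_distrib_right mult.assoc)
      also have "\<dots> = (\<Sum>x\<in>UNIV. \<phi> x * poly (\<Sum>e\<in>?E. p e x * q e k) z)"
        by (subst sum.swap) (simp add: sum_distrib_left poly_sum)
      finally show ?thesis by (simp add: relation)
    qed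
    ultimately show ?thesis unfolding dep_def using x by blast
  qed
  moreover have "\<forall>\<^sub>F z in cofinite. poly D z \<noteq> 0"
  proof -
    have "D \<noteq> 0" using D0 by auto
    then show ?thesis by (simp add: eventually_cofinite poly_roots_finite)
  qed
  ultimately have "lift \<alpha> \<beta> ?E q"
    unfolding lift_def using ends by (auto elim!: eventually_mono)
  then show ?thesis by blast
qed

subsection \<open>Isotopies\<close>

lemma basis_exists:
  assumes "finite E"
  obtains I where "I \<subseteq> E" "\<not> dep \<alpha> I" "\<And>e. e \<in> E - I \<Longrightarrow> dep \<alpha> (insert e I)"
proof -
  let ?F = "{S \<in> Pow E. \<not> dep \<alpha> S}"
  have "finite ?F" "{} \<in> ?F" using assms by (auto simp: dep_def)
  then have "\<exists>I\<in>?F. \<forall>S\<in>?F. I \<subseteq> S \<longrightarrow> I = S"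
    by (intro finite_has_maximal) blast+
  then obtain I where I: "I \<in> ?F" "\<And>S. S \<in> ?F \<Longrightarrow> I \<subseteq> S \<Longrightarrow> I = S"
    by meson
  show ?thesis
  proof (rule that)
    show "dep \<alpha> (insert e I)" if "e \<in> E - I" for e
      using I(1) I(2)[of "insert e I"] that by blast
  qed (use I in auto)
qed

lemma coords_exist:
  assumes "finite E" "I \<subseteq> E" "\<not> dep \<alpha> I" "\<And>e. e \<in> E - I \<Longrightarrow> dep \<alpha> (insert e I)"
  shows "\<exists>X. coords \<alpha> I E X"
proof -
  have fin: "finite I" using assms(1,2) finite_subset by blast
  have "\<exists>x. (\<forall>k. \<alpha> e k = (\<Sum>i\<in>I. x i * \<alpha> i k)) \<and> (\<forall>i. i \<notin> I \<longrightarrow> x i = 0)" if e: "e \<in> E" for e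
  proof (cases "e \<in> I")
    case True
    have "\<alpha> e k = (\<Sum>i\<in>I. (if i = e then 1 else 0) * \<alpha> i k)" for k
    proof -
      have "(\<Sum>i\<in>I. (if i = e then 1 else 0) * \<alpha> i k) = (\<Sum>i\<in>I. if i = e then \<alpha> i k else 0)"
        by (rule sum.cong) auto
      then show ?thesis using fin True by simp
    qed
    then show ?thesis using True by (intro exI[of _ "\<lambda>i. if i = e then 1 else 0"]) auto
  next
    case False
    then obtain c where c: "\<exists>i\<in>insert e I. c i \<noteq> 0" "\<And>k. (\<Sum>i\<in>insert e I. c i * \<alpha> i k) = 0"
      using assms(4)[of e] e unfolding dep_def by blast
    have s: "c e * \<alpha> e k + (\<Sum>i\<in>I. c i * \<alpha> i k) = 0" for k using c(2)[of k] fin False by simp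
    have ce: "c e \<noteq> 0"
    proof
      assume "c e = 0"
      then have "dep \<alpha> I" using c(1) s unfolding dep_def by auto
      with assms(3) show False by blast
    qed
    have "\<alpha> e k = (\<Sum>i\<in>I. (- c i / c e) * \<alpha> i k)" for k
    proof -
      have "(\<Sum>i\<in>I. (- c i / c e) * \<alpha> i k) = - (\<Sum>i\<in>I. c i * \<alpha> i k) / c e"
        by (simp add: sum_divide_distrib sum_negf)
      also have "(\<Sum>i\<in>I. c i * \<alpha> i k) = - (c e * \<alpha> e k)" using s[of k] by (simp add: add_eq_0_iff)
      finally show ?thesis using ce by simp
    qed
    then show ?thesis
      by (intro exI[of _ "\<lambda>i. if i \<in> I then - c i / c e else 0"]) (auto cong: sum.cong)
  qed
  then have "\<exists>X. \<forall>e\<in>E. (\<forall>k. \<alpha> e k = (\<Sum>i\<in>I. X e i * \<alpha> i k)) \<and> (\<forall>i. i \<notin> I \<longrightarrow> X e i = 0)"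
    by metis
  then obtain X where X: "\<And>e. e \<in> E \<Longrightarrow> (\<forall>k. \<alpha> e k = (\<Sum>i\<in>I. X e i * \<alpha> i k)) \<and> (\<forall>i. i \<notin> I \<longrightarrow> X e i = 0)"
    by blast
  then have "coords \<alpha> I E (\<lambda>e i. if e \<in> E then X e i else 0)" unfolding coords_def by simp
  then show ?thesis by blast
qed

text \<open>Coordinates are indexed by a type with exactly three elements, so smaller sets are
  filled up with fresh numbers. In the dual case these must avoid the basis, which is
  \<open>B\<close>.\<close>

lemma three_names:
  fixes A B :: "nat set"
  assumes "finite A" "finite B" "card A \<le> 3" "A \<inter> B = {}"
  obtains h :: "3 \<Rightarrow> nat" where "inj h" "A \<subseteq> range h" "range h \<inter> B = {}"
proof -
  have "infinite (UNIV - (A \<union> B))" using assms by (simp add: Diff_infinite_finite)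
  then obtain C where C: "finite C" "card C = 3 - card A" "C \<subseteq> UNIV - (A \<union> B)"
    using infinite_arbitrarily_large by blast
  have "card (A \<union> C) = 3" using C assms by (subst card_Un_disjoint) auto
  then have "card (UNIV :: 3 set) = card (A \<union> C)" by simp
  then obtain h :: "3 \<Rightarrow> nat" where "bij_betw h UNIV (A \<union> C)"
    using finite_same_card_bij[of "UNIV :: 3 set" "A \<union> C"] C(1) assms(1) by auto
  then show ?thesis using that[of h] C assms by (auto simp: bij_betw_def)
qed

theorem lift_exists:
  fixes \<alpha> \<beta> :: "nat \<Rightarrow> 'k \<Rightarrow> complex"
  assumes fin: "finite E" and seven: "card E \<le> 7"
    and same: "\<And>S. S \<subseteq> E \<Longrightarrow> dep \<alpha> S \<longleftrightarrow> dep \<beta> S"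
  shows "\<exists>q. lift \<alpha> \<beta> E q"
proof -
  obtain I where I: "I \<subseteq> E" "\<not> dep \<alpha> I" "\<And>e. e \<in> E - I \<Longrightarrow> dep \<alpha> (insert e I)"
    using basis_exists[OF fin] by blast
  have I\<beta>: "\<not> dep \<beta> I" "\<And>e. e \<in> E - I \<Longrightarrow> dep \<beta> (insert e I)"
    using I same[of I] same[of "insert _ I"] by auto
  obtain X Y where X: "coords \<alpha> I E X" and Y: "coords \<beta> I E Y"
    using coords_exist[OF fin I] coords_exist[OF fin I(1) I\<beta>] by blast
  have finI: "finite I" using I(1) fin finite_subset by blast
  show ?thesis
  proof (cases "card I \<le> 3")
    case True
    obtain h :: "3 \<Rightarrow> nat" where h: "inj h" "I \<subseteq> range h"
      using three_names[of I "{}"] finI True by auto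
    show ?thesis by (rule lift_low_rank[OF fin seven same h I(2) X I\<beta>(1) Y])
  next
    case False
    then have "card (E - I) \<le> 3" using seven I(1) finI by (simp add: card_Diff_subset)
    then obtain h :: "3 \<Rightarrow> nat" where h: "inj h" "E - I \<subseteq> range h" "range h \<inter> I = {}"
      using three_names[of "E - I" I] fin finI by auto
    \<comment> \<open>Fresh names in \<open>range h\<close> become zero vectors in both families,
      whatever \<open>\<alpha>\<close> and \<open>\<beta>\<close> are outside \<open>E\<close>; a
      set containing one is dependent in both.\<close>
    define a where "a e = (if e \<in> E then \<alpha> e else (\<lambda>_. 0))" for e
    define b where "b e = (if e \<in> E then \<beta> e else (\<lambda>_. 0))" for e
    define L where "L = range h - E"
    have ab: "dep a S \<longleftrightarrow> dep \<alpha> S" "dep b S \<longleftrightarrow> dep \<beta> S" if "S \<subseteq> E" for S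
      by (rule dep_cong; use that in \<open>auto simp: a_def b_def\<close>)+
    have co: "coords \<gamma>' I (range h) (\<lambda>e i. if e \<in> E then Z e i else 0)"
      if "coords \<gamma> I E Z" and g: "\<gamma>' = (\<lambda>e. if e \<in> E then \<gamma> e else (\<lambda>_. 0))" for \<gamma> \<gamma>' :: "nat \<Rightarrow> 'k \<Rightarrow> complex" and Z
    proof -
      have "(\<Sum>i\<in>I. c i * \<gamma>' i k) = (\<Sum>i\<in>I. c i * \<gamma> i k)" for c k
        using I(1) by (intro sum.cong) (auto simp: g)
      then show ?thesis using that(1) unfolding coords_def by (simp add: g)
    qed
    have "\<exists>q. lift a b (I \<union> range h) q"
    proof (rule lift_low_corank[where L = L])
      show "I \<inter> range h = {}" using h(3) by blast
      show "card (I \<union> range h - L) \<le> 7"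
      proof -
        have "I \<union> range h - L = E" using h(2) I(1) by (auto simp: L_def)
        then show ?thesis using seven by simp
      qed
      show "a l k = 0" if "l \<in> L" for l k using that by (simp add: a_def L_def)
      show "dep a S \<longleftrightarrow> dep b S" if S: "S \<subseteq> I \<union> range h" for S
      proof (cases "S \<subseteq> E")
        case True
        then show ?thesis using ab same by blast
      next
        case False
        then obtain l where "l \<in> S" "l \<notin> E" by blast
        moreover have "finite S" using S finI by (simp add: finite_subset)
        ultimately have "dep a S" "dep b S" by (auto intro!: dep_zero[of S l] simp: a_def b_def)
        then show ?thesis by simp
      qed
      show "coords a I (range h) (\<lambda>e i. if e \<in> E then X e i else 0)"
        "coords b I (range h) (\<lambda>e i. if e \<in> E then Y e i else 0)"
        using co X Y by (auto simp: a_def[abs_def] b_def[abs_def])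
    qed (use h finI I I\<beta> ab in \<open>auto simp: L_def\<close>)
    then obtain q where q: "lift a b (I \<union> range h) q" by blast
    have E: "E \<subseteq> I \<union> range h" using h(2) by blast
    have "lift \<alpha> \<beta> E q"
      unfolding lift_def
    proof (intro conjI ballI allI impI)
      fix i k assume i: "i \<in> E"
      then have "poly (q i k) 0 = a i k \<and> poly (q i k) 1 = b i k" using q E unfolding lift_def by blast
      then show "poly (q i k) 0 = \<alpha> i k" "poly (q i k) 1 = \<beta> i k" using i by (simp_all add: a_def b_def)
    next
      fix S assume "S \<subseteq> E" "dep \<alpha> S"
      then have "S \<subseteq> I \<union> range h" "dep a S" using E ab by auto
      then show "\<forall>\<^sub>F z in cofinite. dep (\<lambda>i k. poly (q i k) z) S" using q unfolding lift_def by blast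
    qed
    then show ?thesis by blast
  qed
qed

section \<open>Smooth curves through generic parameters\<close>

lemma smooth_on_poly: "smooth_on I (\<lambda>t. poly p (complex_of_real t))"
proof -
  have der: "((\<lambda>t. poly p (complex_of_real t)) has_vector_derivative poly (pderiv p) (complex_of_real t)) (at t)" for p t
    by (rule has_vector_derivative_real_field) (rule poly_DERIV)
  have iter: "((\<lambda>g t. vector_derivative g (at t)) ^^ k) (\<lambda>t. poly p (complex_of_real t)) =
      (\<lambda>t. poly ((pderiv ^^ k) p) (complex_of_real t))" for k
    by (induction k) (simp_all add: vector_derivative_at[OF der])
  have "(\<lambda>t. poly p (complex_of_real t)) differentiable (at t)" for p t
    using der[of p t] by (auto simp: differentiable_def has_vector_derivative_def)
  then show ?thesis unfolding smooth_on_def iter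
    by (simp add: differentiable_at_imp_differentiable_on)
qed

text \<open>The curve is \<open>t + \<i> c t (1 - t)\<close>. A point \<open>z\<close> off the real axis lies on it for at most one \<open>c\<close>,
  since \<open>t = Re z\<close>, and a real point only for \<open>c = 0\<close> or \<open>z \<in> {0, 1}\<close>.\<close>
lemma curve_avoiding_finite_set:
  fixes B :: "complex set"
  assumes "finite B" "0 \<notin> B" "1 \<notin> B"
  obtains g :: "complex poly" where "poly g 0 = 0" "poly g 1 = 1" "\<And>t. poly g (complex_of_real t) \<notin> B"
proof -
  obtain c :: real where c: "c \<notin> (\<lambda>z. Im z / (Re z * (1 - Re z))) ` B"
    using ex_new_if_finite[OF infinite_UNIV_char_0] assms(1) by blast
  define g where "g = [:0, 1 + \<i> * c, - \<i> * c:]"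
  have "poly g (complex_of_real t) \<notin> B" for t
  proof
    assume B: "poly g (complex_of_real t) \<in> B"
    have g: "poly g (complex_of_real t) = Complex t (c * t * (1 - t))"
      by (simp add: g_def complex_eq_iff algebra_simps)
    have "t \<noteq> 0" "t \<noteq> 1" using B assms g by (auto simp: zero_complex.code one_complex.code)
    then have "c = Im (Complex t (c * t * (1 - t))) / (Re (Complex t (c * t * (1 - t))) * (1 - Re (Complex t (c * t * (1 - t)))))"
      by (simp add: field_simps)
    with c B g show False by force
  qed
  moreover have "poly g 0 = 0" "poly g 1 = 1" by (simp_all add: g_def)
  ultimately show ?thesis using that by blast
qed

theorem theorem3p1:
  fixes A B :: "nat \<Rightarrow> (complex ^ 'd) set" and m :: nat
  assumes "central_arrangement m A" and "central_arrangement m B"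
    and "essential m A" and "essential m B"
    and "matroid_of m A = matroid_of m B"
    and "m \<le> 7"
  shows "isotopic m A B"
proof -
  let ?E = "{1..m}"
  obtain \<alpha> where \<alpha>: "\<And>i. i \<in> ?E \<Longrightarrow> defining_form (\<alpha> i) (A i)"
    using assms(1) unfolding central_arrangement_def by metis
  obtain \<beta> where \<beta>: "\<And>i. i \<in> ?E \<Longrightarrow> defining_form (\<beta> i) (B i)"
    using assms(2) unfolding central_arrangement_def by metis
  have matroid: "S \<in> matroid_of m H \<longleftrightarrow> S \<subseteq> ?E \<and> \<not> dep (\<lambda>i k. \<gamma> i $ k) S"
    if "\<And>i. i \<in> ?E \<Longrightarrow> defining_form (\<gamma> i) (H i)" for S H and \<gamma> :: "nat \<Rightarrow> complex ^ 'd"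
    using matroid_of_iff[of m \<gamma> H S] that lin_indep_family_iff[of S \<gamma>] finite_subset[of S ?E] by auto
  let ?a = "\<lambda>i k. \<alpha> i $ k" and ?b = "\<lambda>i k. \<beta> i $ k"
  have same: "dep ?a S \<longleftrightarrow> dep ?b S" if "S \<subseteq> ?E" for S
    using matroid[where \<gamma> = \<alpha>, OF \<alpha>] matroid[where \<gamma> = \<beta>, OF \<beta>] assms(5) that by blast
  obtain q where q: "lift ?a ?b ?E q"
    using lift_exists[of ?E ?a ?b] same assms(6) by auto
  define good where "good z \<longleftrightarrow> (\<forall>S\<in>Pow ?E. dep (\<lambda>i k. poly (q i k) z) S \<longleftrightarrow> dep ?a S)" for z
  have q01: "poly (q i k) 0 = \<alpha> i $ k" "poly (q i k) 1 = \<beta> i $ k" if "i \<in> ?E" for i k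
    using q that unfolding lift_def by blast+
  have "finite {z. \<not> good z}"
    using lift_generic[OF _ q] unfolding good_def eventually_cofinite by simp
  moreover have "good 0" unfolding good_def
    by (intro ballI dep_cong) (use q01 in auto)
  moreover have "good 1" unfolding good_def
  proof
    fix S assume S: "S \<in> Pow ?E"
    have "dep (\<lambda>i k. poly (q i k) 1) S \<longleftrightarrow> dep ?b S" by (rule dep_cong) (use q01 S in auto)
    then show "dep (\<lambda>i k. poly (q i k) 1) S \<longleftrightarrow> dep ?a S"
      using S same by auto
  qed
  ultimately obtain g :: "complex poly" where g: "poly g 0 = 0" "poly g 1 = 1"
    "\<And>t. good (poly g (complex_of_real t))"
    using curve_avoiding_finite_set[of "{z. \<not> good z}"] by auto
  define \<gamma> :: "nat \<Rightarrow> real \<Rightarrow> complex ^ 'd" where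
    "\<gamma> i t = (\<chi> k. poly (pcompose (q i k) g) (complex_of_real t))" for i t
  define H where "H t i = {x. lin_form (\<gamma> i t) x = 0}" for t i
  have dep\<gamma>: "dep (\<lambda>i k. \<gamma> i t $ k) S \<longleftrightarrow> dep ?a S" if "S \<subseteq> ?E" for t S
    using g(3)[of t] that unfolding good_def by (simp add: \<gamma>_def poly_pcompose)
  have form: "defining_form (\<gamma> i t) (H t i)" if i: "i \<in> ?E" for i t
  proof -
    \<comment> \<open>That a form is nonzero is independence of a singleton, hence part of the
      matroid that is kept along the curve.\<close>
    have "\<not> dep ?a {i}" using \<alpha>[OF i] by (auto simp: dep_1 defining_form_def vec_eq_iff fun_eq_iff)
    then have "\<not> dep (\<lambda>i k. \<gamma> i t $ k) {i}" using dep\<gamma>[of "{i}" t] i by simp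
    then have "\<gamma> i t \<noteq> 0" by (auto simp: dep_1 fun_eq_iff)
    then show ?thesis by (simp add: defining_form_def H_def)
  qed
  \<comment> \<open>Any open interval containing 0 and 1 would do, as the curve avoids the
    exceptions for every real \<open>t\<close>.\<close>
  have "smooth_family m (-1) 2 H"
    unfolding smooth_family_def
  proof (intro exI[of _ \<gamma>] ballI conjI allI)
    fix i k
    show "smooth_on {-1<..<2} (\<lambda>t. \<gamma> i t $ k)"
      unfolding \<gamma>_def vec_lambda_beta by (rule smooth_on_poly)
  qed (rule form)
  moreover have "matroid_of m (H s) = matroid_of m (H t)" for s t
  proof -
    have "S \<in> matroid_of m (H t) \<longleftrightarrow> S \<subseteq> ?E \<and> \<not> dep ?a S" for S t
      using matroid[where \<gamma> = "\<lambda>i. \<gamma> i t" and H = "H t" and S = S, OF form] dep\<gamma>[of S t] by auto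
    then show ?thesis by blast
  qed
  ultimately have "isotopy m (-1) 2 H" unfolding isotopy_def by blast
  moreover have "H 0 i = A i \<and> H 1 i = B i" if i: "i \<in> ?E" for i
  proof -
    have "\<gamma> i 0 = \<alpha> i" "\<gamma> i 1 = \<beta> i" using q01[OF i] g(1,2) by (auto simp: \<gamma>_def poly_pcompose vec_eq_iff)
    then show ?thesis using \<alpha>[OF i] \<beta>[OF i] unfolding H_def defining_form_def by simp
  qed
  ultimately show ?thesis
    unfolding isotopic_def by (intro exI[of _ "-1"] exI[of _ 2] exI[of _ H] conjI bexI[of _ 0] bexI[of _ 1]) auto
qed

end
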